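(* Let $d\ge1$, $s\in(0,1)$, $\lambda,\Lambda>0$, $\rho\ge0$, $A\ge0$, $R_0>0$, $R\in(\rho,R_0]$ and $u\in L^\infty(\mathbb R^d\times I_R)$. Suppose that either (a) $s\ge1/2$ and $u$ satisfies, in the viscosity sense, $$\partial_tu-\Lambda|\nabla u|-\mathcal M_\rho^+u\le A\quad\text{and}\quad\partial_tu+\Lambda|\nabla u|-\mathcal M_\rho^-u\ge-A\quad\text{in }Q_R,$$ or (b) $u$ satisfies, in the viscosity sense, $$\partial_tu-\mathcal M_\rho^+u\le A\quad\text{and}\quad\partial_tu-\mathcal M_\rho^-u\ge-A\quad\text{in }Q_R.$$ Then there exist $\alpha\in(0,2s)$ and $C>0$, depending only on $d,s,\lambda,\Lambda$ in case (b), and only on $d,s,\lambda,\Lambda,R_0$ in case (a), such that $$R^\alpha\frac{|u(x,t)-u(0,0)|}{d((x,t),(0,0))^\alpha}\le C\left(\|u\|_{L^\infty(\mathbb R^d\times I_R)}+R^{2s}A\right)$$ for all $(x,t)\in Q_R\setminus Q_\rho$ (with $(x,t)\neq(0,0)$ if $\rho=0$).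
   Context: Notation: $B_R(x)=\{y\in\mathbb R^d:|x-y|<R\}$, $B_R=B_R(0)$, $I_R=(-R^{2s},0]$, $Q_R=B_R\times I_R$ (so $Q_0=\emptyset$), $d((x,t),(y,\tau))=\max\{|x-y|,|t-\tau|^{1/(2s)}\}$. Kernels: with the convention that $\rho^{-d-2s}=\infty$ if $\rho=0$ (so $\min\{|y|^{-d-2s},\rho^{-d-2s}\}=|y|^{-d-2s}$), $\mathcal K_\rho$ is the set of all measurable $K:\mathbb R^d\to[0,\infty)$ such that (1) $K(y)\ge\lambda\min\{|y|^{-d-2s},\rho^{-d-2s}\}$ for all $y\ne0$; (2) $\int_{B_{2r}\setminus B_r}K(y)\,dy\le\Lambda r^{-2s}$ for all $r>0$; (3) if $s=1/2$, additionally $\int_{B_{2r}\setminus B_r}yK(y)\,dy=0$ for all $r>0$. Operators (acting in space): $\delta_yu(x)=u(x+y)-u(x)$ if $s<1/2$; $\delta_yu(x)=u(x+y)-u(x)-y\cdot\nabla u(x)\mathbf 1_{B_1}(y)$ if $s=1/2$; $\delta_yu(x)=u(x+y)-u(x)-y\cdot\nabla u(x)$ if $s>1/2$. $L_Ku(x)=\int_{\mathbb R^d}\delta_yu(x)K(y)\,dy$, $\mathcal M_\rho^-u(x)=\inf_{K\in\mathcal K_\rho}L_Ku(x)$, $\mathcal M_\rho^+u(x)=\sup_{K\in\mathcal K_\rho}L_Ku(x)$. It is tacitly assumed that $\mathcal K_\rho\neq\emptyset$. Since functions are evaluated pointwise, $L^\infty(\mathbb R^d\times I)$ means bounded Borel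 measurable functions defined everywhere, with the supremum norm. Viscosity sense: let $\Omega\subseteq\mathbb R^d$ be a domain, $I\subseteq(-\infty,0]$ a left-open interval, $f:\Omega\times I\to\mathbb R$, and let $F(v)$ be one of $\mathcal M_\rho^{+}v+\Lambda|\nabla v|$, $\mathcal M_\rho^{-}v-\Lambda|\nabla v|$, $\mathcal M_\rho^\pm v$; $\partial_t$ is the left derivative in time. A function $u\in L^\infty(\mathbb R^d\times I)$ that is upper semicontinuous in $\Omega\times I$ satisfies $\partial_tu-F(u)\le f$ in $\Omega\times I$ in the viscosity sense if for every $(x_0,t_0)\in\Omega\times I$, every $\varepsilon>0$ with $B_\varepsilon(x_0)\times(t_0-\varepsilon,t_0]\subseteq\Omega\times I$ and every $\varphi:B_\varepsilon(x_0)\times(t_0-\varepsilon,t_0]\to\mathbb R$ that is left-differentiable in time and $C^{1,1}$ in space with $u(x_0,t_0)=\varphi(x_0,t_0)$ and $u\le\varphi$ in $B_\varepsilon(x_0)\times(t_0-\varepsilon,t_0]$, the function $v$ equal to $\varphi$ in $B_\varepsilon(x_0)\times(t_0-\varepsilon,t_0]$ and to $u$ elsewhere in $\mathbb R^d\times I$ satisfies $\partial_tv(x_0,t_0)-F(v)(x_0,t_0)\le f(x_0,t_0)$. A function $u\in L^\infty(\mathbb R^d\times I)$ that is lower semicontinuous in $\Omega\times I$ satisfies $\partial_tu-F(u)\ge f$ in the viscosity sense if the same holds with $u\ge\varphi$ in place of $u\le\varphi$ and $\partial_tv(x_0,t_0)-F(v)(x_0,t_0)\ge f(x_0,t_0)$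 as conclusion. *)

theory Defs
  imports "HOL-Analysis.Analysis"
begin

text \<open>
  The space \<open>\<real>\<^sup>d\<close> is a type \<open>'a\<close> of class \<open>euclidean_space\<close>, with \<open>d = DIM('a)\<close>. The parameters
  \<open>l\<close> and \<open>L\<close> stand for \<open>\<lambda>\<close> and \<open>\<Lambda>\<close>, and \<open>r\<close> in the kernel class stands for \<open>\<rho>\<close>.
\<close>

definition time_int :: "real \<Rightarrow> real \<Rightarrow> real set" where
  "time_int s R = {- (R powr (2 * s))<..0}"

definition par_cyl :: "real \<Rightarrow> real \<Rightarrow> ('a::euclidean_space \<times> real) set" where
  "par_cyl s R = ball 0 R \<times> time_int s R"

definition par_dist :: "real \<Rightarrow> 'a::euclidean_space \<times> real \<Rightarrow> 'a \<times> real \<Rightarrow> real" where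
  "par_dist s p q = max (norm (fst p - fst q)) (\<bar>snd p - snd q\<bar> powr (1 / (2 * s)))"

subsection \<open>Kernels and operators\<close>

text \<open>
  The second condition uses the nonnegative integral, so that a non-integrable kernel violates it
  (its Bochner integral would be 0). It makes the integral in the third condition absolutely
  convergent.
\<close>

definition kernels :: "real \<Rightarrow> real \<Rightarrow> real \<Rightarrow> real \<Rightarrow> ('a::euclidean_space \<Rightarrow> real) set" where
  "kernels s l L r = {K.
     K \<in> borel_measurable lebesgue \<and> (\<forall>y. 0 \<le> K y) \<and>
     (\<forall>y. y \<noteq> 0 \<longrightarrow>
        l * (if r = 0 then norm y powr (- real DIM('a) - 2 * s)
             else min (norm y powr (- real DIM('a) - 2 * s)) (r powr (- real DIM('a) - 2 * s))) \<le> K y) \<and>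
     (\<forall>q>0. (\<integral>\<^sup>+y\<in>ball 0 (2 * q) - ball 0 q. ennreal (K y) \<partial>lebesgue)
              \<le> ennreal (L * q powr (- 2 * s))) \<and>
     (s = 1 / 2 \<longrightarrow>
        (\<forall>q>0. set_lebesgue_integral lebesgue (ball 0 (2 * q) - ball 0 q) (\<lambda>y. K y *\<^sub>R y) = 0))}"

definition grad :: "('a::euclidean_space \<Rightarrow> real) \<Rightarrow> 'a \<Rightarrow> 'a" where
  "grad f x = (THE g. GDERIV f x :> g)"

definition delta :: "real \<Rightarrow> 'a::euclidean_space \<Rightarrow> ('a \<Rightarrow> real) \<Rightarrow> 'a \<Rightarrow> real" where
  "delta s y f x =
     (if s < 1 / 2 then f (x + y) - f x
      else if s = 1 / 2 then f (x + y) - f x - (y \<bullet> grad f x) * indicator (ball 0 1) y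
      else f (x + y) - f x - y \<bullet> grad f x)"

definition Lop :: "real \<Rightarrow> ('a::euclidean_space \<Rightarrow> real) \<Rightarrow> ('a \<Rightarrow> real) \<Rightarrow> 'a \<Rightarrow> real" where
  "Lop s K f x = (\<integral>y. delta s y f x * K y \<partial>lebesgue)"

text \<open>
  The extremal operators are only evaluated at points near which \<open>f\<close> is \<open>C\<^sup>1\<^sup>,\<^sup>1\<close>, with \<open>f\<close> bounded
  and Borel. There the integrals converge absolutely and are bounded uniformly over the kernels
  (by the upper bound on dyadic annuli), so the real infimum and supremum are the true ones as
  soon as the class of kernels is nonempty.
\<close>

definition M_minus :: "real \<Rightarrow> real \<Rightarrow> real \<Rightarrow> real \<Rightarrow> ('a::euclidean_space \<Rightarrow> real) \<Rightarrow> 'a \<Rightarrow> real" where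
  "M_minus s l L r f x = (INF K\<in>kernels s l L r. Lop s K f x)"

definition M_plus :: "real \<Rightarrow> real \<Rightarrow> real \<Rightarrow> real \<Rightarrow> ('a::euclidean_space \<Rightarrow> real) \<Rightarrow> 'a \<Rightarrow> real" where
  "M_plus s l L r f x = (SUP K\<in>kernels s l L r. Lop s K f x)"

subsection \<open>Bounded functions and viscosity inequalities\<close>

text \<open>
  A function on \<open>\<real>\<^sup>d \<times> I\<close> is a total function whose values outside \<open>UNIV \<times> I\<close> are never used.
\<close>

definition bdd_borel :: "real set \<Rightarrow> ('a::euclidean_space \<times> real \<Rightarrow> real) set" where
  "bdd_borel I = {u. u \<in> borel_measurable (restrict_space borel (UNIV \<times> I)) \<and>
                     bounded (u ` (UNIV \<times> I))}"

definition sup_norm :: "real set \<Rightarrow> ('a::euclidean_space \<times> real \<Rightarrow> real) \<Rightarrow> real" where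
  "sup_norm I u = (SUP p\<in>UNIV \<times> I. \<bar>u p\<bar>)"

definition usc_on :: "'b::topological_space set \<Rightarrow> ('b \<Rightarrow> real) \<Rightarrow> bool" where
  "usc_on S u \<longleftrightarrow> (\<forall>c. openin (top_of_set S) {p \<in> S. u p < c})"

definition lsc_on :: "'b::topological_space set \<Rightarrow> ('b \<Rightarrow> real) \<Rightarrow> bool" where
  "lsc_on S u \<longleftrightarrow> (\<forall>c. openin (top_of_set S) {p \<in> S. c < u p})"

definition back_cyl :: "'a::euclidean_space \<Rightarrow> real \<Rightarrow> real \<Rightarrow> ('a \<times> real) set" where
  "back_cyl x0 t0 e = ball x0 e \<times> {t0 - e<..t0}"

definition C11_on :: "'a::euclidean_space set \<Rightarrow> ('a \<Rightarrow> real) \<Rightarrow> bool" where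
  "C11_on U f \<longleftrightarrow> (\<exists>g. (\<forall>x\<in>U. GDERIV f x :> g x) \<and> (\<exists>C. C-lipschitz_on U g))"

definition test_fun :: "'a::euclidean_space \<Rightarrow> real \<Rightarrow> real \<Rightarrow> ('a \<times> real \<Rightarrow> real) \<Rightarrow> bool" where
  "test_fun x0 t0 e \<phi> \<longleftrightarrow>
     (\<forall>x\<in>ball x0 e. \<forall>t\<in>{t0 - e<..t0}. (\<lambda>\<tau>. \<phi> (x, \<tau>)) differentiable (at_left t)) \<and>
     (\<forall>t\<in>{t0 - e<..t0}. C11_on (ball x0 e) (\<lambda>x. \<phi> (x, t)))"

definition dt_left :: "('a::euclidean_space \<times> real \<Rightarrow> real) \<Rightarrow> 'a \<Rightarrow> real \<Rightarrow> real" where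
  "dt_left v x t = vector_derivative (\<lambda>\<tau>. v (x, \<tau>)) (at_left t)"

definition glue :: "('a \<times> real) set \<Rightarrow> ('a \<times> real \<Rightarrow> real) \<Rightarrow> ('a \<times> real \<Rightarrow> real) \<Rightarrow> 'a \<times> real \<Rightarrow> real" where
  "glue S \<phi> u p = (if p \<in> S then \<phi> p else u p)"

text \<open>
  \<open>visc_le F f \<Omega> I u\<close> means \<open>\<partial>\<^sub>t u - F(u) \<le> f\<close> in \<open>\<Omega> \<times> I\<close> in the viscosity sense, where the
  operator \<open>F\<close> acts on functions of the space variable; \<open>visc_ge\<close> is the reverse inequality.
\<close>

definition visc_le ::
  "(('a::euclidean_space \<Rightarrow> real) \<Rightarrow> 'a \<Rightarrow> real) \<Rightarrow> ('a \<times> real \<Rightarrow> real) \<Rightarrow>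
     'a set \<Rightarrow> real set \<Rightarrow> ('a \<times> real \<Rightarrow> real) \<Rightarrow> bool" where
  "visc_le F f \<Omega> I u \<longleftrightarrow> u \<in> bdd_borel I \<and> usc_on (\<Omega> \<times> I) u \<and>
     (\<forall>x0 t0 e \<phi>. (x0, t0) \<in> \<Omega> \<times> I \<and> 0 < e \<and> back_cyl x0 t0 e \<subseteq> \<Omega> \<times> I \<and>
        test_fun x0 t0 e \<phi> \<and> u (x0, t0) = \<phi> (x0, t0) \<and> (\<forall>p\<in>back_cyl x0 t0 e. u p \<le> \<phi> p) \<longrightarrow>
        (let v = glue (back_cyl x0 t0 e) \<phi> u
         in dt_left v x0 t0 - F (\<lambda>x. v (x, t0)) x0 \<le> f (x0, t0)))"

definition visc_ge ::
  "(('a::euclidean_space \<Rightarrow> real) \<Rightarrow> 'a \<Rightarrow> real) \<Rightarrow> ('a \<times> real \<Rightarrow> real) \<Rightarrow>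
     'a set \<Rightarrow> real set \<Rightarrow> ('a \<times> real \<Rightarrow> real) \<Rightarrow> bool" where
  "visc_ge F f \<Omega> I u \<longleftrightarrow> u \<in> bdd_borel I \<and> lsc_on (\<Omega> \<times> I) u \<and>
     (\<forall>x0 t0 e \<phi>. (x0, t0) \<in> \<Omega> \<times> I \<and> 0 < e \<and> back_cyl x0 t0 e \<subseteq> \<Omega> \<times> I \<and>
        test_fun x0 t0 e \<phi> \<and> u (x0, t0) = \<phi> (x0, t0) \<and> (\<forall>p\<in>back_cyl x0 t0 e. \<phi> p \<le> u p) \<longrightarrow>
        (let v = glue (back_cyl x0 t0 e) \<phi> u
         in f (x0, t0) \<le> dt_left v x0 t0 - F (\<lambda>x. v (x, t0)) x0))"

subsection \<open>The two hypotheses and the conclusion\<close>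

definition case_a :: "real \<Rightarrow> real \<Rightarrow> real \<Rightarrow> real \<Rightarrow> real \<Rightarrow> real \<Rightarrow> ('a::euclidean_space \<times> real \<Rightarrow> real) \<Rightarrow> bool" where
  "case_a s l L r A R u \<longleftrightarrow> 1 / 2 \<le> s \<and>
     visc_le (\<lambda>f x. M_plus s l L r f x + L * norm (grad f x)) (\<lambda>_. A) (ball 0 R) (time_int s R) u \<and>
     visc_ge (\<lambda>f x. M_minus s l L r f x - L * norm (grad f x)) (\<lambda>_. - A) (ball 0 R) (time_int s R) u"

definition case_b :: "real \<Rightarrow> real \<Rightarrow> real \<Rightarrow> real \<Rightarrow> real \<Rightarrow> real \<Rightarrow> ('a::euclidean_space \<times> real \<Rightarrow> real) \<Rightarrow> bool" where
  "case_b s l L r A R u \<longleftrightarrow>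
     visc_le (M_plus s l L r) (\<lambda>_. A) (ball 0 R) (time_int s R) u \<and>
     visc_ge (M_minus s l L r) (\<lambda>_. - A) (ball 0 R) (time_int s R) u"

definition holder_at_origin ::
  "real \<Rightarrow> real \<Rightarrow> real \<Rightarrow> real \<Rightarrow> real \<Rightarrow> real \<Rightarrow> ('a::euclidean_space \<times> real \<Rightarrow> real) \<Rightarrow> bool" where
  "holder_at_origin s r A R \<alpha> C u \<longleftrightarrow>
     (\<forall>x t. (x, t) \<in> par_cyl s R - par_cyl s r \<and> (r = 0 \<longrightarrow> (x, t) \<noteq> (0, 0)) \<longrightarrow>
        R powr \<alpha> * (\<bar>u (x, t) - u (0, 0)\<bar> / par_dist s (x, t) (0, 0) powr \<alpha>)
          \<le> C * (sup_norm (time_int s R) u + R powr (2 * s) * A))"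

end

theory Submission
  imports Defs
begin

text \<open>
  The oscillation of \<open>u\<close> over the parabolic cylinders of radius \<open>r\<close> about the origin decays
  geometrically in \<open>r\<close>, as long as \<open>r \<ge> \<rho>\<close>. One step of this decay, at a scale \<open>r\<close> where the
  lower bound on the kernels gives \<open>K(y) \<ge> l r\<^sup>-\<^sup>d\<^sup>-\<^sup>2\<^sup>s\<close> for \<open>|y| < r\<close>, goes as follows.

  Let \<open>I \<le> u \<le> S\<close> in the cylinder. Slide the barrier \<open>S - m(t) b(x) + E (t + T)\<close> onto \<open>u\<close> from
  above over the short time interval \<open>[-T, 0]\<close>, with the concave quadratic \<open>b(x) = 1 - 4|x|\<^sup>2/r\<^sup>2\<close> and
  \<open>m\<close> growing at the rate \<open>m'(t) = l r\<^sup>-\<^sup>d\<^sup>-\<^sup>2\<^sup>s \<integral>\<^sub>B (S - u(x, t)) dx\<close>, where \<open>B\<close> is a box of side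
  comparable to \<open>r\<close>. At a first touching point the nonlocal operator sees the gap between barrier
  and \<open>u\<close> on \<open>B\<close>, and this contribution is at least \<open>m'(t)\<close> up to multiples of \<open>m\<close>; it pays for the
  time derivative of the barrier. All other errors are multiples of \<open>m\<close>, of the growth of \<open>u\<close>
  outside the cylinder, and of \<open>A\<close>, and are absorbed by the slope \<open>E\<close>. Hence
  \<open>u \<le> S - m b + E (t + T)\<close> (\<open>one_sided_improvement\<close>, resting on \<open>Lop_upper_bound\<close>).

  Since \<open>m\<close> is of size \<open>T\<close>, the error \<open>E T\<close> it causes is of size \<open>T\<^sup>2\<close> and loses against \<open>m\<close> when \<open>T\<close>
  is a small multiple of \<open>r\<^sup>2\<^sup>s\<close>. The same argument for \<open>-u\<close> raises the lower bound by a second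
  function \<open>m\<close>, and the two rates add up to the constant \<open>l r\<^sup>-\<^sup>d\<^sup>-\<^sup>2\<^sup>s |B| (S - I)\<close>. So the sum of the two
  gains is a fixed fraction of \<open>S - I\<close>, whichever of the bounds \<open>u\<close> is closer to
  (\<open>oscillation_step\<close>). Working with the integral of \<open>S - u\<close> instead of the measure of a level set
  also makes \<open>m\<close> continuously differentiable, so that the barrier is an admissible test function.

  In the iteration (\<open>oscillation_decay\<close>) the decay already known at larger scales bounds \<open>u\<close>
  outside the current cylinder by a function growing like \<open>|x|\<^sup>\<alpha>\<close>, and the excess over the current
  bounds is small when \<open>\<alpha>\<close> is small. The exponent \<open>\<alpha>\<close> and the constants depend on the data only
  through \<open>s\<close>, \<open>l\<close>, \<open>L\<close>, the dimension, and a bound \<open>D'\<close> on the scaled drift \<open>D r\<^sup>2\<^sup>s\<^sup>-\<^sup>1\<close>.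
\<close>

section \<open>Moments of the kernels\<close>

lemma kernelsD:
  fixes K :: "'a::euclidean_space \<Rightarrow> real"
  assumes "K \<in> kernels s l L \<rho>"
  shows "K \<in> borel_measurable lebesgue" "0 \<le> K y"
    and "q > 0 \<Longrightarrow> (\<integral>\<^sup>+y\<in>ball 0 (2 * q) - ball 0 q. ennreal (K y) \<partial>lebesgue) \<le> ennreal (L * q powr (- 2 * s))"
  using assms by (auto simp: kernels_def)

text \<open>
  This is where \<open>\<rho> \<le> r\<close> enters: at scales above \<open>\<rho>\<close> the truncation of the lower bound at \<open>\<rho>\<close> is
  invisible.
\<close>

lemma kernel_lower_bound:
  fixes K :: "'a::euclidean_space \<Rightarrow> real"
  assumes "K \<in> kernels s l L \<rho>" "0 \<le> \<rho>" "\<rho> \<le> r" "0 \<le> l" "y \<noteq> 0" "norm y \<le> r" "0 < s"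
  shows "l * r powr (- real DIM('a) - 2 * s) \<le> K y"
proof -
  have *: "r powr (- real DIM('a) - 2 * s) \<le> a powr (- real DIM('a) - 2 * s)" if "0 < a" "a \<le> r" for a
    using that assms by (intro powr_mono2') auto
  have "r powr (- real DIM('a) - 2 * s)
      \<le> (if \<rho> = 0 then norm y powr (- real DIM('a) - 2 * s)
             else min (norm y powr (- real DIM('a) - 2 * s)) (\<rho> powr (- real DIM('a) - 2 * s)))"
    using *[of "norm y"] *[of \<rho>] assms by auto
  then have "l * r powr (- real DIM('a) - 2 * s)
      \<le> l * (if \<rho> = 0 then norm y powr (- real DIM('a) - 2 * s)
             else min (norm y powr (- real DIM('a) - 2 * s)) (\<rho> powr (- real DIM('a) - 2 * s)))"
    using assms by (intro mult_left_mono) auto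
  also have "\<dots> \<le> K y"
    using assms(1,5) by (auto simp: kernels_def)
  finally show ?thesis .
qed

text \<open>
  The upper bound on the kernel is a bound on its mass in dyadic annuli. Covering \<open>S\<close> by such
  annuli, of inner radii \<open>w j\<close>, bounds the moment by a series, which is geometric both when the
  radii shrink to 0 and when they grow to infinity. The origin can be left uncovered because
  \<open>0 powr \<beta> = 0\<close>.
\<close>

lemma moment_over_annuli:
  fixes K :: "'a::euclidean_space \<Rightarrow> real" and w :: "nat \<Rightarrow> real"
  assumes K: "K \<in> kernels s l L \<rho>" and S: "S \<in> sets lebesgue" and \<beta>: "0 \<le> \<beta>" and L: "0 \<le> L"
    and w: "\<And>j. 0 < w j" and cover: "\<And>y. y \<in> S \<Longrightarrow> y \<noteq> 0 \<Longrightarrow> \<exists>j. w j \<le> norm y \<and> norm y < 2 * w j"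
    and geo: "\<And>j. (2 * w j) powr \<beta> * w j powr (- 2 * s) = c * x ^ j"
    and x: "0 \<le> x" "x < 1" and c: "0 \<le> c"
  shows "integrable lebesgue (\<lambda>y. indicator S y * norm y powr \<beta> * K y)"
    and "(\<integral>y. indicator S y * norm y powr \<beta> * K y \<partial>lebesgue) \<le> L * c / (1 - x)"
proof -
  note [measurable] = kernelsD(1)[OF K] S
  have [measurable]: "(\<lambda>y::'a. norm y powr \<beta>) \<in> borel_measurable lebesgue"
    by (rule measurable_completion) measurable
  let ?f = "\<lambda>y. indicator S y * norm y powr \<beta> * K y"
  let ?A = "\<lambda>j. ball (0::'a) (2 * w j) - ball 0 (w j)"
  have A[measurable]: "?A j \<in> sets lebesgue" for j by auto
  have pt: "ennreal (?f y) \<le> (\<Sum>j. ennreal ((2 * w j) powr \<beta>) * (ennreal (K y) * indicator (?A j) y))" for y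
  proof (cases "y \<in> S \<and> y \<noteq> 0")
    case True
    then obtain j where j: "w j \<le> norm y" "norm y < 2 * w j" using cover by blast
    have "norm y powr \<beta> * K y \<le> (2 * w j) powr \<beta> * K y"
      using j \<beta> kernelsD(2)[OF K] by (intro mult_right_mono powr_mono2) auto
    then have "ennreal (?f y) \<le> ennreal ((2 * w j) powr \<beta>) * (ennreal (K y) * indicator (?A j) y)"
      using True j by (simp add: ennreal_mult'[symmetric] kernelsD(2)[OF K] ennreal_leI)
    also have "\<dots> \<le> (\<Sum>j. ennreal ((2 * w j) powr \<beta>) * (ennreal (K y) * indicator (?A j) y))"
      using sum_le_suminf[of "\<lambda>j. ennreal ((2 * w j) powr \<beta>) * (ennreal (K y) * indicator (?A j) y)" "{j}"]
      by simp
    finally show ?thesis .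
  qed auto
  have "(\<integral>\<^sup>+y. ennreal (?f y) \<partial>lebesgue)
      \<le> (\<integral>\<^sup>+y. (\<Sum>j. ennreal ((2 * w j) powr \<beta>) * (ennreal (K y) * indicator (?A j) y)) \<partial>lebesgue)"
    by (intro nn_integral_mono pt)
  also have "\<dots> = (\<Sum>j. ennreal ((2 * w j) powr \<beta>) * (\<integral>\<^sup>+y. ennreal (K y) * indicator (?A j) y \<partial>lebesgue))"
    by (subst nn_integral_suminf) (auto intro!: suminf_cong nn_integral_cmult)
  also have "\<dots> \<le> (\<Sum>j. ennreal ((2 * w j) powr \<beta>) * ennreal (L * w j powr (- 2 * s)))"
    using kernelsD(3)[OF K w] by (intro suminf_le mult_left_mono) auto
  also have "\<dots> = (\<Sum>j. ennreal (L * c * x ^ j))"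
  proof (rule suminf_cong)
    fix j
    have "(2 * w j) powr \<beta> * (L * w j powr (- 2 * s)) = L * c * x ^ j"
      using geo[of j] by (simp add: algebra_simps)
    then show "ennreal ((2 * w j) powr \<beta>) * ennreal (L * w j powr (- 2 * s)) = ennreal (L * c * x ^ j)"
      by (subst ennreal_mult'[symmetric]) (auto simp only: powr_ge_zero)
  qed
  also have "\<dots> = ennreal (L * c / (1 - x))"
  proof (rule suminf_ennreal_eq)
    show "(\<lambda>j. L * c * x ^ j) sums (L * c / (1 - x))"
      using sums_mult[OF geometric_sums[of x], of "L * c"] x by simp
  qed (use x c L in auto)
  finally have bound: "(\<integral>\<^sup>+y. ennreal (?f y) \<partial>lebesgue) \<le> ennreal (L * c / (1 - x))" .
  have nonneg: "0 \<le> ?f y" for y using kernelsD(2)[OF K] by auto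
  show int: "integrable lebesgue ?f"
    using bound by (intro integrableI_nonneg) (auto simp: nonneg less_top[symmetric] top_unique)
  show "(\<integral>y. ?f y \<partial>lebesgue) \<le> L * c / (1 - x)"
  proof -
    have "ennreal (\<integral>y. ?f y \<partial>lebesgue) \<le> ennreal (L * c / (1 - x))"
      using bound nn_integral_eq_integral[OF int] nonneg by simp
    then show ?thesis
      using x c L by (subst (asm) ennreal_le_iff) auto
  qed
qed

lemma dyadic_scale_exists:
  fixes a z :: real
  assumes "0 < a" "a \<le> z"
  shows "\<exists>n. 2 ^ n * a \<le> z \<and> z < 2 * (2 ^ n * a)"
proof -
  define n where "n = nat \<lfloor>log 2 (z / a)\<rfloor>"
  have "0 \<le> log 2 (z / a)" using assms by simp
  then have "real n \<le> log 2 (z / a)" "log 2 (z / a) < real n + 1"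
    unfolding n_def by linarith+
  then have "2 powr real n \<le> z / a" "z / a < 2 powr (real n + 1)"
    using assms by (auto simp: le_log_iff log_less_iff)
  then have "2 ^ n \<le> z / a" "z / a < 2 * 2 ^ n"
    by (auto simp: powr_realpow powr_add)
  with assms show ?thesis
    by (intro exI[of _ n]) (auto simp: field_simps)
qed

definition near_const :: "real \<Rightarrow> real \<Rightarrow> real" where
  "near_const s \<beta> = 2 powr (2 * s) / (1 - 2 powr (2 * s - \<beta>))"

definition far_const :: "real \<Rightarrow> real \<Rightarrow> real" where
  "far_const s \<beta> = 2 powr \<beta> / (1 - 2 powr (\<beta> - 2 * s))"

lemma far_moment:
  fixes K :: "'a::euclidean_space \<Rightarrow> real"
  assumes K: "K \<in> kernels s l L \<rho>" and \<beta>: "0 \<le> \<beta>" "\<beta> < 2 * s" and L: "0 \<le> L" and q: "0 < q"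
  shows "integrable lebesgue (\<lambda>y. indicator (- ball 0 q) y * norm y powr \<beta> * K y)"
    and "(\<integral>y. indicator (- ball 0 q) y * norm y powr \<beta> * K y \<partial>lebesgue)
           \<le> far_const s \<beta> * L * q powr (\<beta> - 2 * s)"
proof -
  have geo: "(2 * (2 ^ j * q)) powr \<beta> * (2 ^ j * q) powr (- 2 * s)
      = 2 powr \<beta> * q powr (\<beta> - 2 * s) * (2 powr (\<beta> - 2 * s)) ^ j" for j :: nat
    using q by (simp add: powr_def ln_mult ln_realpow exp_add[symmetric] exp_of_nat_mult[symmetric] algebra_simps)
  have cover: "\<exists>j. 2 ^ j * q \<le> norm y \<and> norm y < 2 * (2 ^ j * q)" if "y \<in> - ball 0 q" for y :: 'a
    using dyadic_scale_exists[OF q, of "norm y"] that by auto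
  have "2 powr (\<beta> - 2 * s) < 1" using \<beta> by (simp add: powr_less_one)
  note * = moment_over_annuli[OF K _ \<beta>(1) L _ _ geo _ this, of "- ball 0 q"]
  show "integrable lebesgue (\<lambda>y. indicator (- ball 0 q) y * norm y powr \<beta> * K y)"
    using * cover q by auto
  show "(\<integral>y. indicator (- ball 0 q) y * norm y powr \<beta> * K y \<partial>lebesgue)
           \<le> far_const s \<beta> * L * q powr (\<beta> - 2 * s)"
    using *(2) cover q by (auto simp: far_const_def mult_ac)
qed

lemma near_moment:
  fixes K :: "'a::euclidean_space \<Rightarrow> real"
  assumes K: "K \<in> kernels s l L \<rho>" and \<beta>: "0 \<le> \<beta>" "2 * s < \<beta>" and L: "0 \<le> L" and q: "0 < q"
  shows "integrable lebesgue (\<lambda>y. indicator (ball 0 q) y * norm y powr \<beta> * K y)"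
    and "(\<integral>y. indicator (ball 0 q) y * norm y powr \<beta> * K y \<partial>lebesgue)
           \<le> near_const s \<beta> * L * q powr (\<beta> - 2 * s)"
proof -
  have geo: "(2 * (q / 2 ^ Suc j)) powr \<beta> * (q / 2 ^ Suc j) powr (- 2 * s)
      = 2 powr (2 * s) * q powr (\<beta> - 2 * s) * (2 powr (2 * s - \<beta>)) ^ j" for j :: nat
    using q by (simp add: powr_def ln_mult ln_div ln_realpow exp_add[symmetric] exp_of_nat_mult[symmetric] algebra_simps)
  have cover: "\<exists>j. q / 2 ^ Suc j \<le> norm y \<and> norm y < 2 * (q / 2 ^ Suc j)"
    if y: "y \<in> ball 0 q" "y \<noteq> 0" for y :: 'a
  proof -
    obtain n where n: "2 ^ n * norm y \<le> q" "q < 2 * (2 ^ n * norm y)"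
      using dyadic_scale_exists[of "norm y" q] y by auto
    show ?thesis
    proof (cases "2 ^ n * norm y = q")
      case True
      then have "n \<noteq> 0" using y by (cases n) auto
      then obtain k where "n = Suc k" using not0_implies_Suc by blast
      then show ?thesis using True y by (intro exI[of _ k]) (auto simp: field_simps)
    next
      case False
      then show ?thesis using n by (intro exI[of _ n]) (auto simp: field_simps)
    qed
  qed
  have "2 powr (2 * s - \<beta>) < 1" using \<beta> by (simp add: powr_less_one)
  note * = moment_over_annuli[OF K _ \<beta>(1) L _ _ geo _ this, of "ball 0 q"]
  show "integrable lebesgue (\<lambda>y. indicator (ball 0 q) y * norm y powr \<beta> * K y)"
    using *(1) cover q by auto
  show "(\<integral>y. indicator (ball 0 q) y * norm y powr \<beta> * K y \<partial>lebesgue)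
           \<le> near_const s \<beta> * L * q powr (\<beta> - 2 * s)"
    using *(2) cover q by (auto simp: near_const_def mult_ac)
qed

text \<open>
  For \<open>s = 1/2\<close> the operator compensates by \<open>y\<close> on the unit ball, which does not scale. At scale \<open>r\<close> the
  unit ball has to be replaced by one of radius comparable to \<open>r\<close>. The following vector is the price of this change.
\<close>

definition ring_moment :: "('a::euclidean_space \<Rightarrow> real) \<Rightarrow> real \<Rightarrow> real \<Rightarrow> 'a" where
  "ring_moment K a b = (\<integral>y. (indicator (ball 0 b) y - indicator (ball 0 a) y) *\<^sub>R (K y *\<^sub>R y) \<partial>lebesgue)"

lemma borel_measurable_lebesgueI:
  "f \<in> borel_measurable borel \<Longrightarrow> f \<in> borel_measurable lebesgue"
  by (rule measurable_completion) simp

lemma ring_in_one_annulus: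
  fixes K :: "'a::euclidean_space \<Rightarrow> real"
  assumes K: "K \<in> kernels (1/2) l L \<rho>" and ab: "0 < a" "a \<le> b" "b \<le> 2 * a" and L: "0 \<le> L"
  shows "integrable lebesgue (\<lambda>y. (indicator (ball 0 b) y - indicator (ball 0 a) y) *\<^sub>R (K y *\<^sub>R y))"
    and "norm (ring_moment K a b) \<le> 2 * L"
proof -
  note [measurable] = kernelsD(1)[OF K]
  have [measurable]: "ball (0::'a) c \<in> sets lebesgue" for c by auto
  have [measurable]: "(\<lambda>y::'a. y) \<in> borel_measurable lebesgue"
    by (rule borel_measurable_lebesgueI) simp
  let ?f = "\<lambda>y::'a. (indicator (ball 0 b) y - indicator (ball 0 a) y :: real) *\<^sub>R (K y *\<^sub>R y)"
  have meas: "?f \<in> borel_measurable lebesgue"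
    by (intro borel_measurable_scaleR borel_measurable_diff borel_measurable_indicator) auto
  have "ennreal (norm (?f y)) \<le> ennreal (2 * a) * (ennreal (K y) * indicator (ball 0 (2 * a) - ball 0 a) y)" for y
  proof (cases "a \<le> norm y \<and> norm y < b")
    case True
    then have "norm (?f y) \<le> 2 * a * K y"
      using ab kernelsD(2)[OF K, of y] mult_right_mono[of "norm y" "2 * a" "K y"]
      by (auto simp: indicator_def mult_ac)
    then show ?thesis
      using True ab kernelsD(2)[OF K, of y]
      by (auto simp: ennreal_mult'[symmetric] intro!: ennreal_leI)
  next
    case False
    then show ?thesis using ab by (auto simp: indicator_def)
  qed
  then have "(\<integral>\<^sup>+y. ennreal (norm (?f y)) \<partial>lebesgue)
      \<le> (\<integral>\<^sup>+y. ennreal (2 * a) * (ennreal (K y) * indicator (ball 0 (2 * a) - ball 0 a) y) \<partial>lebesgue)"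
    by (intro nn_integral_mono)
  also have "\<dots> = ennreal (2 * a) * (\<integral>\<^sup>+y\<in>ball 0 (2 * a) - ball 0 a. ennreal (K y) \<partial>lebesgue)"
    by (intro nn_integral_cmult) auto
  also have "\<dots> \<le> ennreal (2 * a) * ennreal (L * a powr (- 2 * (1/2)))"
    using kernelsD(3)[OF K ab(1)] by (intro mult_left_mono) auto
  also have "\<dots> = ennreal (2 * L)"
    using ab by (subst ennreal_mult'[symmetric]) (auto simp: powr_minus divide_simps)
  finally have bound: "(\<integral>\<^sup>+y. ennreal (norm (?f y)) \<partial>lebesgue) \<le> ennreal (2 * L)" .
  show int: "integrable lebesgue ?f"
    using bound meas by (intro integrableI_bounded) (auto simp: less_top[symmetric] top_unique)
  have "ennreal (norm (integral\<^sup>L lebesgue ?f)) \<le> ennreal (2 * L)"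
    using integral_norm_bound_ennreal[OF int] bound by (rule order_trans)
  then show "norm (ring_moment K a b) \<le> 2 * L"
    using L unfolding ring_moment_def by (subst (asm) ennreal_le_iff) auto
qed

text \<open>
  The cancellation condition only concerns annuli whose radii have ratio 2. It removes all complete
  dyadic annuli between \<open>a\<close> and \<open>b\<close>, and the remaining piece lies in a single one, where
  the absolute first moment is at most \<open>2 L\<close>.
\<close>

lemma ring_moment_bounded:
  fixes K :: "'a::euclidean_space \<Rightarrow> real"
  assumes K: "K \<in> kernels (1/2) l L \<rho>" and ab: "0 < a" "a \<le> b" and L: "0 \<le> L"
  shows "integrable lebesgue (\<lambda>y. (indicator (ball 0 b) y - indicator (ball 0 a) y) *\<^sub>R (K y *\<^sub>R y))"
    and "norm (ring_moment K a b) \<le> 2 * L"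
proof -
  let ?f = "\<lambda>a b y. (indicator (ball 0 b) y - indicator (ball 0 a) y :: real) *\<^sub>R (K y *\<^sub>R (y::'a))"
  have split: "?f a c = (\<lambda>y. ?f a b y + ?f b c y)" for a b c :: real
    by (auto simp: fun_eq_iff algebra_simps)
  have dyadic: "ring_moment K q (2 * q) = 0" if "0 < q" for q
  proof -
    have "set_lebesgue_integral lebesgue (ball 0 (2 * q) - ball 0 q) (\<lambda>y. K y *\<^sub>R y) = 0"
      using K that by (auto simp: kernels_def)
    moreover have "indicator (ball 0 (2 * q) - ball 0 q) y = (indicator (ball 0 (2 * q)) y - indicator (ball 0 q) y :: real)" for y :: 'a
      using that by (auto simp: indicator_def)
    ultimately show ?thesis
      by (simp add: ring_moment_def set_lebesgue_integral_def)
  qed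
  have pow: "integrable lebesgue (?f a (2 ^ n * a)) \<and> ring_moment K a (2 ^ n * a) = 0" for n
  proof (induction n)
    case 0
    then show ?case by (simp add: ring_moment_def)
  next
    case (Suc n)
    have i: "integrable lebesgue (?f (2 ^ n * a) (2 * (2 ^ n * a)))"
      using ab by (intro ring_in_one_annulus(1)[OF K _ _ _ L]) auto
    have e: "?f a (2 ^ Suc n * a) = (\<lambda>y. ?f a (2 ^ n * a) y + ?f (2 ^ n * a) (2 * (2 ^ n * a)) y)"
      by (auto simp: fun_eq_iff algebra_simps)
    show ?case
      using Suc i dyadic[of "2 ^ n * a"] ab
      unfolding ring_moment_def e by (auto simp: Bochner_Integration.integral_add)
  qed
  obtain n where n: "2 ^ n * a \<le> b" "b < 2 * (2 ^ n * a)"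
    using dyadic_scale_exists[OF ab] by blast
  have pos: "0 < 2 ^ n * a" using ab by simp
  note last = ring_in_one_annulus[OF K pos n(1) less_imp_le[OF n(2)] L]
  show "integrable lebesgue (?f a b)"
    using pow[of n] last(1) by (subst split[where a = a and b = "2 ^ n * a" and c = b]) (intro Bochner_Integration.integrable_add, auto)
  have "ring_moment K a b = ring_moment K a (2 ^ n * a) + ring_moment K (2 ^ n * a) b"
    using pow[of n] last(1) unfolding ring_moment_def
    by (subst split[where a = a and b = "2 ^ n * a" and c = b]) (intro Bochner_Integration.integral_add, auto)
  then show "norm (ring_moment K a b) \<le> 2 * L"
    using pow[of n] last(2) by simp
qed

lemma recentering_drift_bounded:
  fixes K :: "'a::euclidean_space \<Rightarrow> real" and p :: 'a
  assumes K: "K \<in> kernels (1/2) l L \<rho>" and q: "0 < q" and L: "0 \<le> L"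
  shows "integrable lebesgue (\<lambda>y. (y \<bullet> p) * (indicator (ball 0 1) y - indicator (ball 0 q) y) * K y)"
    and "\<bar>\<integral>y. (y \<bullet> p) * (indicator (ball 0 1) y - indicator (ball 0 q) y) * K y \<partial>lebesgue\<bar> \<le> 2 * L * norm p"
proof -
  let ?f = "\<lambda>a b y. (indicator (ball 0 b) y - indicator (ball 0 a) y :: real) *\<^sub>R (K y *\<^sub>R (y::'a))"
  have "integrable lebesgue (?f q 1) \<and> norm (\<integral>y. ?f q 1 y \<partial>lebesgue) \<le> 2 * L"
  proof (cases "q \<le> 1")
    case True
    then show ?thesis using ring_moment_bounded[OF K q _ L, of 1] by (simp add: ring_moment_def)
  next
    case False
    have e: "?f q 1 = (\<lambda>y. - ?f 1 q y)" by (auto simp: fun_eq_iff algebra_simps)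
    show ?thesis
      unfolding e using False ring_moment_bounded[OF K _ _ L, of 1 q] by (simp add: ring_moment_def)
  qed
  then have i: "integrable lebesgue (?f q 1)" and b: "norm (\<integral>y. ?f q 1 y \<partial>lebesgue) \<le> 2 * L" by auto
  have e: "(\<lambda>y. (y \<bullet> p) * (indicator (ball 0 1) y - indicator (ball 0 q) y) * K y) = (\<lambda>y. ?f q 1 y \<bullet> p)"
    by (auto simp: fun_eq_iff)
  show "integrable lebesgue (\<lambda>y. (y \<bullet> p) * (indicator (ball 0 1) y - indicator (ball 0 q) y) * K y)"
    unfolding e using i by (rule integrable_inner_left)
  have "(\<integral>y. ?f q 1 y \<bullet> p \<partial>lebesgue) = (\<integral>y. ?f q 1 y \<partial>lebesgue) \<bullet> p"
    using i by (intro integral_inner_left) auto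
  also have "\<bar>\<dots>\<bar> \<le> norm (\<integral>y. ?f q 1 y \<partial>lebesgue) * norm p"
    by (rule Cauchy_Schwarz_ineq2)
  also have "\<dots> \<le> 2 * L * norm p"
    using b by (intro mult_right_mono) auto
  finally show "\<bar>\<integral>y. (y \<bullet> p) * (indicator (ball 0 1) y - indicator (ball 0 q) y) * K y \<partial>lebesgue\<bar> \<le> 2 * L * norm p"
    unfolding e .
qed

section \<open>Viscosity inequalities as one-sided conditions\<close>

lemma grad_eqI:
  assumes "GDERIV f x :> g"
  shows "grad f x = g"
  unfolding grad_def
proof (rule the_equality)
  show "GDERIV f x :> g" by fact
  fix h assume "GDERIV f x :> h"
  with assms have "(\<lambda>v. v \<bullet> g) = (\<lambda>v. v \<bullet> h)"
    unfolding gderiv_def by (intro has_derivative_unique)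
  then have "(h - g) \<bullet> (h - g) = 0"
    by (metis diff_self inner_diff_right)
  then show "h = g" by simp
qed

lemma continuous_on_if_usc_lsc:
  fixes u :: "'b::topological_space \<Rightarrow> real"
  assumes "usc_on S u" "lsc_on S u"
  shows "continuous_on S u"
  unfolding continuous_on_def
proof
  fix x assume x: "x \<in> S"
  show "(u \<longlongrightarrow> u x) (at x within S)"
  proof (rule order_tendstoI)
    fix c assume c: "c < u x"
    obtain T where "open T" "{p \<in> S. c < u p} = S \<inter> T"
      using assms(2) by (auto simp: lsc_on_def openin_open)
    with x c show "\<forall>\<^sub>F y in at x within S. c < u y"
      unfolding eventually_at_topological by blast
  next
    fix c assume c: "u x < c"
    obtain T where "open T" "{p \<in> S. u p < c} = S \<inter> T"
      using assms(1) by (auto simp: usc_on_def openin_open)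
    with x c show "\<forall>\<^sub>F y in at x within S. u y < c"
      unfolding eventually_at_topological by blast
  qed
qed

text \<open>
  The inequality \<open>\<partial>\<^sub>t u - M\<^sup>+ u - D |\<nabla>u| \<le> A\<close> in the form in which it is used: an upper bound \<open>c\<close> for
  all linear operators of the class replaces the supremum. Both viscosity inequalities take this
  form, the lower one after passing to \<open>-u\<close>, and both cases of the theorem are covered, with
  \<open>D = L\<close> or \<open>D = 0\<close>.
\<close>

definition subsolution ::
  "real \<Rightarrow> real \<Rightarrow> real \<Rightarrow> real \<Rightarrow> real \<Rightarrow> real \<Rightarrow> real \<Rightarrow> ('a::euclidean_space \<times> real \<Rightarrow> real) \<Rightarrow> bool" where
  "subsolution s l L \<rho> D A R u \<longleftrightarrow>
     u \<in> bdd_borel (time_int s R) \<and> continuous_on (par_cyl s R) u \<and>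
     (\<forall>x0 t0 e \<phi> c. (x0, t0) \<in> ball 0 R \<times> time_int s R \<and> 0 < e \<and>
        back_cyl x0 t0 e \<subseteq> ball 0 R \<times> time_int s R \<and> test_fun x0 t0 e \<phi> \<and>
        u (x0, t0) = \<phi> (x0, t0) \<and> (\<forall>p\<in>back_cyl x0 t0 e. u p \<le> \<phi> p) \<and>
        (\<forall>K\<in>kernels s l L \<rho>. Lop s K (\<lambda>x. glue (back_cyl x0 t0 e) \<phi> u (x, t0)) x0 \<le> c) \<longrightarrow>
        dt_left (glue (back_cyl x0 t0 e) \<phi> u) x0 t0
          \<le> A + c + D * norm (grad (\<lambda>x. glue (back_cyl x0 t0 e) \<phi> u (x, t0)) x0))"

text \<open>
  A left derivative at \<open>t0\<close> also involves the value at \<open>t0\<close> itself, which the half-open backward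
  cylinder contains.
\<close>

lemma dt_left_glue:
  assumes "((\<lambda>\<tau>. \<phi> (x0, \<tau>)) has_vector_derivative d) (at_left t0)" "0 < e"
  shows "((\<lambda>\<tau>. glue (back_cyl x0 t0 e) \<phi> u (x0, \<tau>)) has_vector_derivative d) (at_left t0)"
    and "dt_left (glue (back_cyl x0 t0 e) \<phi> u) x0 t0 = d"
proof -
  show *: "((\<lambda>\<tau>. glue (back_cyl x0 t0 e) \<phi> u (x0, \<tau>)) has_vector_derivative d) (at_left t0)"
  proof -
    have "\<forall>\<^sub>F \<tau> in nhds t0. t0 - e < \<tau>"
      using assms(2) by (intro eventually_nhds_in_open[of "{t0 - e<..}" t0, simplified]) auto
    then have "\<forall>\<^sub>F \<tau> in nhds t0. \<tau> \<in> {..<t0} \<longrightarrow> glue (back_cyl x0 t0 e) \<phi> u (x0, \<tau>) = \<phi> (x0, \<tau>)"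
      by eventually_elim (use assms(2) in \<open>auto simp: glue_def back_cyl_def\<close>)
    moreover have "glue (back_cyl x0 t0 e) \<phi> u (x0, t0) = \<phi> (x0, t0)"
      using assms(2) by (auto simp: glue_def back_cyl_def)
    ultimately show ?thesis
      by (subst has_vector_derivative_cong_ev[where g = "\<lambda>\<tau>. \<phi> (x0, \<tau>)"]) (auto intro: assms(1))
  qed
  show "dt_left (glue (back_cyl x0 t0 e) \<phi> u) x0 t0 = d"
    unfolding dt_left_def by (rule vector_derivative_within[OF _ *]) simp
qed

lemma GDERIV_glue:
  assumes "GDERIV (\<lambda>x. \<phi> (x, t0)) x0 :> g" "0 < e"
  shows "GDERIV (\<lambda>x. glue (back_cyl x0 t0 e) \<phi> u (x, t0)) x0 :> g"
  unfolding gderiv_def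
  by (rule has_derivative_transform_within_open[OF assms(1)[unfolded gderiv_def], of "ball x0 e"])
    (use assms(2) in \<open>auto simp: glue_def back_cyl_def\<close>)

lemma subsolution_of_visc_le:
  fixes u :: "'a::euclidean_space \<times> real \<Rightarrow> real"
  assumes le: "visc_le (\<lambda>f x. M_plus s l L \<rho> f x + D * norm (grad f x)) (\<lambda>_. A) (ball 0 R) (time_int s R) u"
    and lsc: "lsc_on (ball 0 R \<times> time_int s R) u" and ne: "(kernels s l L \<rho> :: ('a \<Rightarrow> real) set) \<noteq> {}"
  shows "subsolution s l L \<rho> D A R u"
  unfolding subsolution_def
proof (intro conjI allI impI)
  show "u \<in> bdd_borel (time_int s R)" using le by (simp add: visc_le_def)
  show "continuous_on (par_cyl s R) u"
    using le lsc unfolding par_cyl_def by (intro continuous_on_if_usc_lsc) (auto simp: visc_le_def)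
  fix x0 :: 'a and t0 e \<phi> c
  let ?v = "glue (back_cyl x0 t0 e) \<phi> u"
  assume a: "(x0, t0) \<in> ball 0 R \<times> time_int s R \<and> 0 < e \<and>
        back_cyl x0 t0 e \<subseteq> ball 0 R \<times> time_int s R \<and> test_fun x0 t0 e \<phi> \<and>
        u (x0, t0) = \<phi> (x0, t0) \<and> (\<forall>p\<in>back_cyl x0 t0 e. u p \<le> \<phi> p) \<and>
        (\<forall>K\<in>kernels s l L \<rho>. Lop s K (\<lambda>x. ?v (x, t0)) x0 \<le> c)"
  then have "dt_left ?v x0 t0 - (M_plus s l L \<rho> (\<lambda>x. ?v (x, t0)) x0 + D * norm (grad (\<lambda>x. ?v (x, t0)) x0)) \<le> A"
    using le unfolding visc_le_def Let_def by blast
  moreover have "M_plus s l L \<rho> (\<lambda>x. ?v (x, t0)) x0 \<le> c"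
    unfolding M_plus_def using a ne by (intro cSUP_least) auto
  ultimately show "dt_left ?v x0 t0 \<le> A + c + D * norm (grad (\<lambda>x. ?v (x, t0)) x0)" by linarith
qed

lemma grad_uminus:
  assumes "GDERIV f x :> g"
  shows "grad (\<lambda>x. - f x) x = - grad f x"
proof -
  have "GDERIV (\<lambda>x. - f x) x :> - g" using assms by (rule GDERIV_minus)
  then show ?thesis using assms by (simp add: grad_eqI)
qed

lemma Lop_uminus:
  assumes "GDERIV f x :> g"
  shows "Lop s K (\<lambda>x. - f x) x = - Lop s K f x"
proof -
  have "delta s y (\<lambda>x. - f x) x = - delta s y f x" for y
    by (simp add: delta_def grad_uminus[OF assms])
  then show ?thesis by (simp add: Lop_def)
qed

lemma test_fun_uminus:
  assumes "test_fun x0 t0 e \<phi>"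
  shows "test_fun x0 t0 e (\<lambda>p. - \<phi> p)"
  unfolding test_fun_def
proof (intro conjI ballI)
  fix x t assume "x \<in> ball x0 e" "t \<in> {t0 - e<..t0}"
  then show "(\<lambda>\<tau>. - \<phi> (x, \<tau>)) differentiable at_left t"
    using assms by (auto simp: test_fun_def)
next
  fix t assume "t \<in> {t0 - e<..t0}"
  then have "C11_on (ball x0 e) (\<lambda>x. \<phi> (x, t))" using assms by (auto simp: test_fun_def)
  then obtain g C where g: "\<forall>x\<in>ball x0 e. GDERIV (\<lambda>x. \<phi> (x, t)) x :> g x" "C-lipschitz_on (ball x0 e) g"
    unfolding C11_on_def by blast
  have "\<forall>x\<in>ball x0 e. GDERIV (\<lambda>x. - \<phi> (x, t)) x :> - g x"
    using g(1) by (auto intro: GDERIV_minus)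
  moreover have "C-lipschitz_on (ball x0 e) (\<lambda>x. - g x)"
    using g(2) by simp
  ultimately show "C11_on (ball x0 e) (\<lambda>x. - \<phi> (x, t))"
    unfolding C11_on_def by (intro exI[of _ "\<lambda>x. - g x"]) blast
qed

lemma bdd_borel_uminus:
  assumes "u \<in> bdd_borel I"
  shows "(\<lambda>p. - u p) \<in> bdd_borel I"
proof -
  have "(\<lambda>p. - u p) ` (UNIV \<times> I) = uminus ` (u ` (UNIV \<times> I))" by auto
  then show ?thesis using assms by (auto simp: bdd_borel_def bounded_uminus)
qed

lemma subsolution_of_visc_ge:
  fixes u :: "'a::euclidean_space \<times> real \<Rightarrow> real"
  assumes ge: "visc_ge (\<lambda>f x. M_minus s l L \<rho> f x - D * norm (grad f x)) (\<lambda>_. - A) (ball 0 R) (time_int s R) u"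
    and usc: "usc_on (ball 0 R \<times> time_int s R) u" and ne: "(kernels s l L \<rho> :: ('a \<Rightarrow> real) set) \<noteq> {}"
  shows "subsolution s l L \<rho> D A R (\<lambda>p. - u p)"
  unfolding subsolution_def
proof (intro conjI allI impI)
  show "(\<lambda>p. - u p) \<in> bdd_borel (time_int s R)"
    using ge by (auto simp: visc_ge_def intro: bdd_borel_uminus)
  show "continuous_on (par_cyl s R) (\<lambda>p. - u p)"
    using ge usc unfolding par_cyl_def
    by (intro continuous_on_minus continuous_on_if_usc_lsc) (auto simp: visc_ge_def)
  fix x0 :: 'a and t0 e \<phi> c
  let ?v = "glue (back_cyl x0 t0 e) \<phi> (\<lambda>p. - u p)"
  assume a: "(x0, t0) \<in> ball 0 R \<times> time_int s R \<and> 0 < e \<and>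
        back_cyl x0 t0 e \<subseteq> ball 0 R \<times> time_int s R \<and> test_fun x0 t0 e \<phi> \<and>
        - u (x0, t0) = \<phi> (x0, t0) \<and> (\<forall>p\<in>back_cyl x0 t0 e. - u p \<le> \<phi> p) \<and>
        (\<forall>K\<in>kernels s l L \<rho>. Lop s K (\<lambda>x. ?v (x, t0)) x0 \<le> c)"
  let ?w = "glue (back_cyl x0 t0 e) (\<lambda>p. - \<phi> p) u"
  have w: "?w = (\<lambda>p. - ?v p)" by (auto simp: glue_def fun_eq_iff)
  have "C11_on (ball x0 e) (\<lambda>x. \<phi> (x, t0))" "x0 \<in> ball x0 e"
    using a by (auto simp: test_fun_def)
  then obtain g where "GDERIV (\<lambda>x. \<phi> (x, t0)) x0 :> g"
    unfolding C11_on_def by blast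
  then have G: "GDERIV (\<lambda>x. ?v (x, t0)) x0 :> g" using a by (intro GDERIV_glue) auto
  have "(\<lambda>\<tau>. \<phi> (x0, \<tau>)) differentiable (at_left t0)"
    using a by (auto simp: test_fun_def)
  then obtain d where d: "((\<lambda>\<tau>. \<phi> (x0, \<tau>)) has_vector_derivative d) (at_left t0)"
    by (auto simp: vector_derivative_works)
  have dw: "dt_left ?w x0 t0 = - d"
    using a by (intro dt_left_glue has_vector_derivative_minus d) auto
  have "u (x0, t0) = - \<phi> (x0, t0)" using a by linarith
  moreover have "\<forall>p\<in>back_cyl x0 t0 e. - \<phi> p \<le> u p" using a by (auto simp: minus_le_iff)
  moreover have "test_fun x0 t0 e (\<lambda>p. - \<phi> p)" using a by (auto intro: test_fun_uminus)
  ultimately have "- A \<le> dt_left ?w x0 t0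
      - (M_minus s l L \<rho> (\<lambda>x. ?w (x, t0)) x0 - D * norm (grad (\<lambda>x. ?w (x, t0)) x0))"
    using ge a unfolding visc_ge_def Let_def by blast
  moreover have "- c \<le> M_minus s l L \<rho> (\<lambda>x. ?w (x, t0)) x0"
    unfolding M_minus_def w using a ne by (intro cINF_greatest) (auto simp: Lop_uminus[OF G])
  moreover have "norm (grad (\<lambda>x. ?w (x, t0)) x0) = norm (grad (\<lambda>x. ?v (x, t0)) x0)"
    unfolding w by (simp add: grad_uminus[OF G])
  moreover have "dt_left ?v x0 t0 = d" using a by (intro dt_left_glue d) auto
  ultimately show "dt_left ?v x0 t0 \<le> A + c + D * norm (grad (\<lambda>x. ?v (x, t0)) x0)"
    unfolding dw by simp
qed

section \<open>The operator at a touching point\<close>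

text \<open>
  A concave quadratic rather than a cutoff function: it is nonpositive outside the ball of radius
  \<open>r / 2\<close>, which keeps the touching point inside that ball, and its second differences
  are explicit.
\<close>

definition bump :: "real \<Rightarrow> 'a::euclidean_space \<Rightarrow> real" where
  "bump r x = 1 - 4 * (norm x)\<^sup>2 / r\<^sup>2"

lemma GDERIV_bump: "GDERIV (bump r) x :> (- (8 / r\<^sup>2)) *\<^sub>R x"
proof -
  have *: "((\<lambda>x. 1 - c * (x \<bullet> x)) has_derivative (\<lambda>h. h \<bullet> (- (2 * c)) *\<^sub>R x)) (at x)" for c
    by (auto intro!: derivative_eq_intros simp: inner_commute algebra_simps)
  have "bump r = (\<lambda>x::'a. 1 - 4 / r\<^sup>2 * (x \<bullet> x))"
    by (simp add: bump_def power2_norm_eq_inner fun_eq_iff)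
  then show ?thesis
    unfolding gderiv_def using *[of "4 / r\<^sup>2"] by simp
qed

lemma GDERIV_bump_affine: "GDERIV (\<lambda>x. c - m * bump r x) x :> (8 * m / r\<^sup>2) *\<^sub>R x"
  using GDERIV_bump[of r x] unfolding gderiv_def
  by (auto intro!: derivative_eq_intros simp: algebra_simps)

lemma bump_diff:
  "bump r x - bump r (x + y) = (8 * (x \<bullet> y) + 4 * (norm y)\<^sup>2) / r\<^sup>2"
  unfolding bump_def power2_norm_eq_inner
  by (simp add: inner_add_left inner_add_right inner_commute diff_divide_distrib[symmetric] add_divide_distrib[symmetric] algebra_simps)

text \<open>
  Powers of \<open>|y|\<close> that dominate the compensated difference of a smooth bounded function near the
  origin and at infinity. They depend on how \<open>s\<close> compares with \<open>1/2\<close>, that is, on the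
  compensator.
\<close>

definition near_exp :: "real \<Rightarrow> real" where "near_exp s = (if s < 1/2 then 1 else 2)"
definition far_exp :: "real \<Rightarrow> real" where "far_exp s = (if s \<le> 1/2 then 0 else 1)"

text \<open>
  The moments are taken inside and outside a ball of radius \<open>r / 2\<close>, which accounts for the powers
  of 2; the summand 8 pays for moving the compensator when \<open>s = 1/2\<close>.
\<close>

definition diffusion_const :: "real \<Rightarrow> real" where
  "diffusion_const s = 16 * (near_const s (near_exp s) * 2 powr (2 * s - near_exp s)
     + far_const s (far_exp s) * 2 powr (2 * s - far_exp s)) + 8"

definition tail_const :: "real \<Rightarrow> real" where
  "tail_const s = far_const s s * 2 powr (2 * s)"

lemma exps: "0 < s \<Longrightarrow> s < 1 \<Longrightarrow> 2 * s < near_exp s \<and> 0 \<le> near_exp s \<and> far_exp s < 2 * s \<and> 0 \<le> far_exp s"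
  by (auto simp: near_exp_def far_exp_def)

lemma near_const_pos: "2 * s < \<beta> \<Longrightarrow> 0 < near_const s \<beta>"
  by (auto simp: near_const_def powr_less_one intro!: divide_pos_pos)
lemma far_const_pos: "\<beta> < 2 * s \<Longrightarrow> 0 < far_const s \<beta>"
  by (auto simp: far_const_def powr_less_one intro!: divide_pos_pos)

lemma diffusion_const_pos: "0 < s \<Longrightarrow> s < 1 \<Longrightarrow> 0 < diffusion_const s"
  using exps[of s] near_const_pos[of s "near_exp s"] far_const_pos[of "far_exp s" s]
  by (auto simp: diffusion_const_def intro!: add_nonneg_pos)

lemma tail_const_pos: "0 < s \<Longrightarrow> 0 < tail_const s"
  using far_const_pos[of s s] by (auto simp: tail_const_def)

lemma integrable_against_kernel:
  fixes K :: "'a::euclidean_space \<Rightarrow> real"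
  assumes s: "0 < s" "s < 1" and K: "K \<in> kernels s l L \<rho>" and L: "0 \<le> L" and q: "0 < q"
    and F: "F \<in> borel_measurable borel"
    and near: "\<And>y. norm y < q \<Longrightarrow> \<bar>F y\<bar> \<le> M * norm y powr near_exp s"
    and far: "\<And>y. q \<le> norm y \<Longrightarrow> \<bar>F y\<bar> \<le> M * norm y powr far_exp s"
  shows "integrable lebesgue (\<lambda>y. F y * K y)"
proof (rule Bochner_Integration.integrable_bound)
  note e = exps[OF s]
  show "integrable lebesgue (\<lambda>y. M * (indicator (ball 0 q) y * norm y powr near_exp s * K y)
      + M * (indicator (- ball 0 q) y * norm y powr far_exp s * K y))"
    using near_moment(1)[OF K _ _ L q] far_moment(1)[OF K _ _ L q] e
    by (intro Bochner_Integration.integrable_add integrable_mult_right) auto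
  show "(\<lambda>y. F y * K y) \<in> borel_measurable lebesgue"
    using borel_measurable_lebesgueI[OF F] kernelsD(1)[OF K] by (rule borel_measurable_times)
  have "\<bar>F y\<bar> * K y \<le> \<bar>M * (indicator (ball 0 q) y * norm y powr near_exp s * K y)
      + M * (indicator (- ball 0 q) y * norm y powr far_exp s * K y)\<bar>" for y
    using near[of y] far[of y] kernelsD(2)[OF K, of y] 
      mult_right_mono[of "\<bar>F y\<bar>" "M * norm y powr near_exp s" "K y"]
      mult_right_mono[of "\<bar>F y\<bar>" "M * norm y powr far_exp s" "K y"]
    by (cases "norm y < q") (auto simp: mult_ac intro: order_trans[OF _ abs_ge_self])
  then show "AE y in lebesgue. norm (F y * K y) \<le> norm (M * (indicator (ball 0 q) y * norm y powr near_exp s * K y)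
      + M * (indicator (- ball 0 q) y * norm y powr far_exp s * K y))"
    using kernelsD(2)[OF K] by (intro AE_I2) (simp add: abs_mult)
qed

lemma shifted_box_integral:
  fixes g :: "'a::euclidean_space \<Rightarrow> real"
  assumes g: "continuous_on (cbox a b) g"
  shows "integrable lebesgue (\<lambda>y. indicator (cbox a b) (x0 + y) * g (x0 + y))"
    and "(\<integral>y. indicator (cbox a b) (x0 + y) * g (x0 + y) \<partial>lebesgue) = integral (cbox a b) g"
proof -
  let ?G = "\<lambda>x. indicator (cbox a b) x * g x"
  have i: "integrable lborel ?G"
    using borel_integrable_compact[OF compact_cbox g] by simp
  then have [measurable]: "?G \<in> borel_measurable borel"
    using borel_measurable_integrable by fastforce
  have d: "lborel = distr lborel borel ((+) x0)" by (simp add: lborel_distr_plus)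
  have i': "integrable lborel (\<lambda>y. ?G (x0 + y))"
    using i by (subst (asm) d) (subst (asm) integrable_distr_eq, auto)
  then show "integrable lebesgue (\<lambda>y. ?G (x0 + y))"
    by (subst integrable_completion) auto
  have "(\<integral>y. ?G (x0 + y) \<partial>lebesgue) = (\<integral>y. ?G (x0 + y) \<partial>lborel)"
    by (intro integral_completion) measurable
  also have "\<dots> = (\<integral>x. ?G x \<partial>lborel)"
    by (subst (2) d) (subst integral_distr, auto)
  also have "\<dots> = integral (cbox a b) g"
    using set_borel_integral_eq_integral(2)[of "cbox a b" g] i
    by (simp add: set_integrable_def set_lebesgue_integral_def)
  finally show "(\<integral>y. ?G (x0 + y) \<partial>lebesgue) = integral (cbox a b) g" .
qed

text \<open>
  Here \<open>f\<close> is a time slice of a function that the barrier touches from above at \<open>x0\<close>, already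
  replaced by the barrier near \<open>x0\<close>. The quadratic part of the barrier costs a multiple of
  \<open>m r\<^sup>-\<^sup>2\<^sup>s\<close>, the growth of \<open>f\<close> outside \<open>B\<^sub>r\<close> a multiple of \<open>\<kappa> r\<^sup>-\<^sup>2\<^sup>s\<close>. The gap between \<open>f\<close> and the
  barrier on the box, of which \<open>g\<close> is a lower bound, is weighted by \<open>K\<close>, which is at least \<open>l r\<^sup>-\<^sup>d\<^sup>-\<^sup>2\<^sup>s\<close> on the relevant set,
  and yields the negative term.
\<close>

lemma Lop_upper_bound:
  fixes f :: "'a::euclidean_space \<Rightarrow> real"
  assumes s: "0 < s" "s < 1" and K: "K \<in> kernels s l L \<rho>" and \<rho>: "0 \<le> \<rho>" "\<rho> \<le> r" and r: "0 < r"
    and l: "0 \<le> l" and L: "0 \<le> L" and x0: "norm x0 < r / 2" and m: "0 \<le> m" and \<kappa>: "0 \<le> \<kappa>"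
    and fm: "f \<in> borel_measurable borel" and fB: "\<And>x. \<bar>f x\<bar> \<le> B"
    and e: "0 < e" and quad: "\<And>x. x \<in> ball x0 e \<Longrightarrow> f x = f x0 + m * (bump r x0 - bump r x)"
    and upper: "\<And>x. x \<in> ball 0 r \<Longrightarrow> f x \<le> f x0 + m * (bump r x0 - bump r x)"
    and tail: "\<And>x. x \<notin> ball 0 r \<Longrightarrow> f x \<le> f x0 + m + \<kappa> * (norm x / r) powr s"
    and box: "cbox a b \<subseteq> ball 0 (r / 2)" and g: "continuous_on (cbox a b) g"
    and fg: "\<And>x. x \<in> cbox a b \<Longrightarrow> f x + g x \<le> f x0 + m * (bump r x0 - bump r x)"
  shows "Lop s K f x0 \<le> diffusion_const s * L * m * r powr (- 2 * s) + tail_const s * L * \<kappa> * r powr (- 2 * s)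
           - l * r powr (- real DIM('a) - 2 * s) * integral (cbox a b) g"
proof -
  define n where "n = near_exp s"
  define k where "k = far_exp s"
  note ex = exps[OF s, folded n_def k_def]
  define p where "p = (8 * m / r\<^sup>2) *\<^sub>R x0"
  define c where "c = (\<lambda>y::'a. if s < 1/2 then 0 else if s = 1/2 then indicator (ball 0 (r / 2)) y *\<^sub>R y else y)"
  define F where "F = (\<lambda>y. f (x0 + y) - f x0 - c y \<bullet> p)"
  \<comment> \<open>what the compensator of the operator differs from \<open>c\<close> by; this is not zero for \<open>s = 1/2\<close>\<close>
  define cor where "cor = (\<lambda>y. if s = 1/2 then (y \<bullet> p) * (indicator (ball 0 1) y - indicator (ball 0 (r / 2)) y :: real) else 0)"
  define X where "X = (\<lambda>y. y \<bullet> p)"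
  define z where "z = (\<lambda>y::'a. norm y / r)"
  define N where "N = (\<lambda>y::'a. indicator (ball 0 (r / 2)) y * norm y powr n :: real)"
  define FF where "FF = (\<lambda>y::'a. indicator (- ball 0 (r / 2)) y * norm y powr k :: real)"
  define TT where "TT = (\<lambda>y::'a. indicator (- ball 0 (r / 2)) y * norm y powr s :: real)"
  define H where "H = (\<lambda>y. 16 * m * r powr (- n) * N y + 16 * m * r powr (- k) * FF y + \<kappa> * (2 / r) powr s * TT y)"
  define G where "G = (\<lambda>y. indicator (cbox a b) (x0 + y) * g (x0 + y))"
  let ?l = "l * r powr (- real DIM('a) - 2 * s)"
  have Kp: "0 \<le> K y" for y using kernelsD(2)[OF K] .
  have zp: "0 \<le> z y" for y using r by (simp add: z_def)
  have norm_p: "norm p \<le> 4 * m / r"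
  proof -
    have "norm p = 8 * m / r\<^sup>2 * norm x0" using m by (simp add: p_def)
    also have "\<dots> \<le> 8 * m / r\<^sup>2 * (r / 2)"
      using x0 m by (intro mult_left_mono) auto
    finally show ?thesis using r by (simp add: power2_eq_square field_simps)
  qed
  have Xz: "\<bar>X y\<bar> \<le> 4 * m * z y" for y
  proof -
    have "\<bar>X y\<bar> \<le> norm y * norm p" unfolding X_def by (rule Cauchy_Schwarz_ineq2)
    also have "\<dots> \<le> norm y * (4 * m / r)" using norm_p by (intro mult_left_mono) auto
    finally show ?thesis by (simp add: z_def field_simps)
  qed
  have bump_z: "m * (bump r x0 - bump r (x0 + y)) = X y + 4 * m * (z y)\<^sup>2" for y
    by (simp add: bump_diff X_def p_def z_def power_divide inner_commute add_divide_distrib algebra_simps)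
  have grad: "GDERIV f x0 :> p"
  proof -
    have "((\<lambda>x. (f x0 + m * bump r x0) - m * bump r x) has_derivative (\<lambda>h. h \<bullet> p)) (at x0)"
      using GDERIV_bump_affine[of "f x0 + m * bump r x0" m r x0] unfolding gderiv_def p_def .
    then have "(f has_derivative (\<lambda>h. h \<bullet> p)) (at x0)"
    proof (rule has_derivative_transform_within_open)
      show "open (ball x0 e)" "x0 \<in> ball x0 e" using e by auto
      show "f x0 + m * bump r x0 - m * bump r x = f x" if "x \<in> ball x0 e" for x
        using quad[OF that] by (simp only: algebra_simps)
    qed
    then show ?thesis by (simp add: gderiv_def)
  qed
  have delta_eq: "delta s y f x0 = F y - cor y" for y
    by (auto simp: delta_def F_def cor_def c_def grad_eqI[OF grad] algebra_simps)
  have pw: "norm y powr n = (if s < 1/2 then norm y else (norm y)\<^sup>2)"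
    "norm y powr k = (if s \<le> 1/2 then (if y = 0 then 0 else 1) else norm y)" for y :: 'a
    by (auto simp: n_def k_def near_exp_def far_exp_def)
  have npw: "norm y powr n * r powr (- n) = (if s < 1/2 then z y else (z y)\<^sup>2)"
    "norm y powr k * r powr (- k) = (if s \<le> 1/2 then (if y = 0 then 0 else 1) else z y)" for y :: 'a
    using r by (auto simp: pw powr_minus z_def n_def k_def near_exp_def far_exp_def field_simps power2_eq_square)
  \<comment> \<open>\<open>f\<close> is only known to be quadratic on the ball of radius \<open>e\<close>, so the splitting radius and the
    bound depend on \<open>e\<close>; only integrability is concluded from them\<close>
  have int_F: "integrable lebesgue (\<lambda>y. F y * K y)"
  proof -
    define q where "q = min e (r / 2)"
    define M where "M = (norm p + 4 * m / r\<^sup>2 * q + 4 * m / r\<^sup>2) + (2 * B + norm p * (r / 2)) + ((2 * B) / q + norm p)"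
    have q: "0 < q" "q \<le> e" "q \<le> r / 2" using e r by (auto simp: q_def)
    have B: "0 \<le> B" using fB[of 0] by linarith
    have Xp: "\<bar>X y\<bar> \<le> norm p * norm y" for y
      using Cauchy_Schwarz_ineq2[of y p] by (simp add: X_def mult.commute)
    have Fm: "F \<in> borel_measurable borel"
    proof -
      have "(\<lambda>y. f (x0 + y)) \<in> borel_measurable borel" using fm by measurable
      moreover have "c \<in> borel_measurable borel" unfolding c_def
        by (cases "s < 1/2"; cases "s = 1/2") (auto intro!: borel_measurable_scaleR borel_measurable_indicator)
      ultimately show ?thesis unfolding F_def by measurable
    qed
    show ?thesis
    proof (rule integrable_against_kernel[OF s K L q(1) Fm, where M = M])
      fix y :: 'a
      assume y: "norm y < q"
      then have "f (x0 + y) = f x0 + m * (bump r x0 - bump r (x0 + y))"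
        using q by (intro quad) (auto simp: dist_norm)
      then have F1: "F y = X y + 4 * m * (z y)\<^sup>2 - c y \<bullet> p" using bump_z by (simp add: F_def)
      have yr: "y \<in> ball 0 (r / 2)" using y q by auto
      have sq: "4 * m * (z y)\<^sup>2 = 4 * m / r\<^sup>2 * (norm y)\<^sup>2" by (simp add: z_def power_divide)
      have "\<bar>F y\<bar> \<le> (norm p + 4 * m / r\<^sup>2 * q + 4 * m / r\<^sup>2) * norm y powr n"
      proof (cases "s < 1/2")
        case True
        have "4 * m / r\<^sup>2 * (norm y)\<^sup>2 \<le> 4 * m / r\<^sup>2 * (q * norm y)"
          using y m unfolding power2_eq_square by (intro mult_left_mono mult_right_mono) auto
        moreover have "0 \<le> 4 * m / r\<^sup>2 * (norm y)\<^sup>2" "0 \<le> 4 * m / r\<^sup>2 * norm y" using m by auto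
        ultimately show ?thesis
          using True Xp[of y] F1 sq by (simp add: c_def pw algebra_simps)
      next
        case False
        then have "F y = 4 * m / r\<^sup>2 * (norm y)\<^sup>2"
          using F1 yr sq by (auto simp: c_def X_def)
        then have "\<bar>F y\<bar> = 4 * m / r\<^sup>2 * (norm y)\<^sup>2" using m by (simp only: abs_of_nonneg) simp
        moreover have "0 \<le> 4 * m / r\<^sup>2 * (norm y)\<^sup>2" "0 \<le> norm p * (norm y)\<^sup>2" "0 \<le> 4 * m / r\<^sup>2 * q * (norm y)\<^sup>2"
          using m q by auto
        ultimately show ?thesis using False by (simp add: pw algebra_simps)
      qed
      also have "\<dots> \<le> M * norm y powr n"
        using B q m by (intro mult_right_mono) (auto simp: M_def r intro!: add_nonneg_nonneg mult_nonneg_nonneg less_imp_le[OF r])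
      finally show "\<bar>F y\<bar> \<le> M * norm y powr near_exp s" by (simp add: n_def)
    next
      fix y :: 'a
      assume y: "q \<le> norm y"
      then have y0: "y \<noteq> 0" using q by auto
      have f2: "\<bar>f (x0 + y) - f x0\<bar> \<le> 2 * B" using fB[of "x0 + y"] fB[of x0] by linarith
      have cp: "\<bar>c y \<bullet> p\<bar> \<le> norm p * norm (c y)"
        using Cauchy_Schwarz_ineq2[of "c y" p] by (simp add: mult.commute)
      have "\<bar>F y\<bar> \<le> ((2 * B + norm p * (r / 2)) + ((2 * B) / q + norm p)) * norm y powr k"
      proof (cases "s \<le> 1/2")
        case True
        then have "norm (c y) \<le> r / 2" using r by (auto simp: c_def indicator_def)
        then have "norm p * norm (c y) \<le> norm p * (r / 2)" by (intro mult_left_mono) auto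
        moreover have "0 \<le> 2 * B / q" using B q by auto
        ultimately show ?thesis
          using True y0 f2 cp norm_ge_zero[of p] by (simp add: pw F_def del: norm_ge_zero) 
      next
        case False
        have "2 * B \<le> 2 * B / q * norm y"
          using y q B by (simp add: field_simps mult_left_mono)
        moreover have "0 \<le> (2 * B + norm p * (r / 2)) * norm y" using B r by auto
        ultimately show ?thesis
          using False f2 cp by (simp add: pw F_def c_def algebra_simps)
      qed
      also have "\<dots> \<le> M * norm y powr k"
        using B q m by (intro mult_right_mono) (auto simp: M_def)
      finally show "\<bar>F y\<bar> \<le> M * norm y powr far_exp s" by (simp add: k_def)
    qed
  qed
  have int_cor: "integrable lebesgue (\<lambda>y. cor y * K y)"
    and cor_bd: "\<bar>\<integral>y. cor y * K y \<partial>lebesgue\<bar> \<le> 8 * L * m * r powr (- 2 * s)"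
  proof -
    have "integrable lebesgue (\<lambda>y. cor y * K y) \<and> \<bar>\<integral>y. cor y * K y \<partial>lebesgue\<bar> \<le> 8 * L * m * r powr (- 2 * s)"
    proof (cases "s = 1/2")
      case True
      have K': "K \<in> kernels (1/2) l L \<rho>" and r2: "0 < r / 2" using K True r by auto
      note * = recentering_drift_bounded[OF K' r2 L, of p]
      have "2 * L * norm p \<le> 2 * L * (4 * m / r)" using norm_p L by (intro mult_left_mono) auto
      moreover have "- 2 * s = - (1::real)" using True by simp
      then have "r powr (- 2 * s) = inverse r" using r by (simp only: powr_minus) simp
      then have "2 * L * (4 * m / r) = 8 * L * m * r powr (- 2 * s)"
        by (simp add: divide_inverse)
      ultimately have "2 * L * norm p \<le> 8 * L * m * r powr (- 2 * s)" by linarith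
      from order_trans[OF *(2) this] *(1) show ?thesis
        unfolding cor_def if_P[OF True] by blast
    next
      case False
      then show ?thesis using L m by (simp add: cor_def)
    qed
    then show "integrable lebesgue (\<lambda>y. cor y * K y)"
      "\<bar>\<integral>y. cor y * K y \<partial>lebesgue\<bar> \<le> 8 * L * m * r powr (- 2 * s)" by auto
  qed
  have r2: "0 < r / 2" using r by simp
  have N: "integrable lebesgue (\<lambda>y. N y * K y)"
      "(\<integral>y. N y * K y \<partial>lebesgue) \<le> near_const s n * L * (r / 2) powr (n - 2 * s)"
    unfolding N_def using near_moment[OF K _ _ L r2, of n] ex by auto
  have FF: "integrable lebesgue (\<lambda>y. FF y * K y)"
      "(\<integral>y. FF y * K y \<partial>lebesgue) \<le> far_const s k * L * (r / 2) powr (k - 2 * s)"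
    unfolding FF_def using far_moment[OF K _ _ L r2, of k] ex by auto
  have TT: "integrable lebesgue (\<lambda>y. TT y * K y)"
      "(\<integral>y. TT y * K y \<partial>lebesgue) \<le> far_const s s * L * (r / 2) powr (s - 2 * s)"
    unfolding TT_def using far_moment[OF K _ _ L r2, of s] s by auto
  have H_eq: "H y * K y = 16 * m * r powr (- n) * (N y * K y) + 16 * m * r powr (- k) * (FF y * K y)
      + \<kappa> * (2 / r) powr s * (TT y * K y)" for y
    by (simp add: H_def algebra_simps)
  have int_H: "integrable lebesgue (\<lambda>y. H y * K y)"
    unfolding H_eq using N FF TT by (intro Bochner_Integration.integrable_add integrable_mult_right) auto
  have H_bd: "(\<integral>y. H y * K y \<partial>lebesgue) \<le> (diffusion_const s - 8) * L * m * r powr (- 2 * s)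
      + tail_const s * L * \<kappa> * r powr (- 2 * s)"
  proof -
    have "(\<integral>y. H y * K y \<partial>lebesgue) = 16 * m * r powr (- n) * (\<integral>y. N y * K y \<partial>lebesgue)
        + 16 * m * r powr (- k) * (\<integral>y. FF y * K y \<partial>lebesgue) + \<kappa> * (2 / r) powr s * (\<integral>y. TT y * K y \<partial>lebesgue)"
      unfolding H_eq using N FF TT
      by (subst Bochner_Integration.integral_add, auto)+
    also have "\<dots> \<le> 16 * m * r powr (- n) * (near_const s n * L * (r / 2) powr (n - 2 * s))
        + 16 * m * r powr (- k) * (far_const s k * L * (r / 2) powr (k - 2 * s))
        + \<kappa> * (2 / r) powr s * (far_const s s * L * (r / 2) powr (s - 2 * s))"
      using N FF TT m \<kappa> by (intro add_mono mult_left_mono) auto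
    also have "\<dots> = (diffusion_const s - 8) * L * m * r powr (- 2 * s) + tail_const s * L * \<kappa> * r powr (- 2 * s)"
    proof -
      have 1: "r powr (- t) * (r / 2) powr (t - 2 * s) = 2 powr (2 * s - t) * r powr (- 2 * s)" for t
        using r by (simp add: powr_def ln_div exp_add[symmetric] algebra_simps)
      have 2: "(2 / r) powr s * (r / 2) powr (s - 2 * s) = 2 powr (2 * s) * r powr (- 2 * s)"
        using r by (simp add: powr_def ln_div exp_add[symmetric] algebra_simps)
      have "16 * m * r powr (- n) * (near_const s n * L * (r / 2) powr (n - 2 * s))
        + 16 * m * r powr (- k) * (far_const s k * L * (r / 2) powr (k - 2 * s))
        + \<kappa> * (2 / r) powr s * (far_const s s * L * (r / 2) powr (s - 2 * s))
        = 16 * m * near_const s n * L * (r powr (- n) * (r / 2) powr (n - 2 * s))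
        + 16 * m * far_const s k * L * (r powr (- k) * (r / 2) powr (k - 2 * s))
        + \<kappa> * far_const s s * L * ((2 / r) powr s * (r / 2) powr (s - 2 * s))"
        by (simp add: algebra_simps)
      then show ?thesis
        unfolding 1 2 diffusion_const_def tail_const_def n_def[symmetric] k_def[symmetric]
        by (simp add: algebra_simps)
    qed
    finally show ?thesis .
  qed
  have in_ball: "m * (bump r x0 - bump r (x0 + y)) - c y \<bullet> p \<le> H y" if y: "x0 + y \<in> ball 0 r" for y
  proof -
    have k0: "0 \<le> \<kappa> * (2 / r) powr s * TT y" using \<kappa> by (auto simp: TT_def)
    have mz: "0 \<le> m * z y" "0 \<le> m * (z y)\<^sup>2" using m zp by auto
    show ?thesis
    proof (cases "norm y < r / 2")
      case True
      then have z2: "z y \<le> 1/2" using r by (simp add: z_def field_simps)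
      have "m * (z y)\<^sup>2 \<le> m * z y"
        using m zp[of y] z2 unfolding power2_eq_square by (intro mult_left_mono mult_left_le) auto
      then have "X y + 4 * m * (z y)\<^sup>2 - c y \<bullet> p \<le> 16 * m * (norm y powr n * r powr (- n))"
        using Xz[of y] mz True unfolding npw by (auto simp: c_def X_def)
      also have "\<dots> \<le> H y"
        using True k0 by (simp add: H_def N_def FF_def mult_ac)
      finally show ?thesis unfolding bump_z .
    next
      case False
      then have y0: "y \<noteq> 0" using r by auto
      have "norm y \<le> norm (x0 + y) + norm x0"
        using norm_triangle_ineq4[of "x0 + y" x0] by simp
      then have "norm y \<le> 3 / 2 * r" using y x0 by auto
      then have z2: "z y \<le> 3/2" using r by (simp add: z_def field_simps)
      have "m * (z y)\<^sup>2 \<le> m * (z y * (3 / 2))"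
        using m zp[of y] z2 unfolding power2_eq_square by (intro mult_left_mono) auto
      moreover have "m * z y \<le> m * (3 / 2)" using m z2 by (intro mult_left_mono) auto
      ultimately have "X y + 4 * m * (z y)\<^sup>2 - c y \<bullet> p \<le> 16 * m * (norm y powr k * r powr (- k))"
        using Xz[of y] mz False y0 unfolding npw by (auto simp: c_def X_def)
      also have "\<dots> \<le> H y"
        using False k0 by (simp add: H_def N_def FF_def mult_ac)
      finally show ?thesis unfolding bump_z .
    qed
  qed
  have out_ball: "F y \<le> H y" if y: "x0 + y \<notin> ball 0 r" for y
  proof -
    have "r \<le> norm (x0 + y)" using y by auto
    moreover have "norm (x0 + y) \<le> norm x0 + norm y" by (rule norm_triangle_ineq)
    ultimately have y2: "r / 2 \<le> norm y" and xy: "norm (x0 + y) \<le> 2 * norm y" using x0 by linarith+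
    then have y0: "y \<noteq> 0" using r by auto
    have z2: "1/2 \<le> z y" using y2 r by (simp add: z_def field_simps)
    have "(norm (x0 + y) / r) powr s \<le> (2 / r * norm y) powr s"
      using xy r s by (intro powr_mono2) (auto simp: field_simps)
    also have "\<dots> = (2 / r) powr s * TT y"
      using powr_mult[of "2 / r" "norm y" s] y2 r by (simp add: TT_def)
    finally have "\<kappa> * (norm (x0 + y) / r) powr s \<le> \<kappa> * (2 / r) powr s * TT y"
      using \<kappa> by (simp add: mult_left_mono mult.assoc)
    then have 1: "f (x0 + y) - f x0 \<le> m + \<kappa> * (2 / r) powr s * TT y"
      using tail[OF y] by linarith
    have "m * (1/2) \<le> m * z y" using m z2 by (intro mult_left_mono) auto
    then have "m - c y \<bullet> p \<le> 16 * m * (norm y powr k * r powr (- k))"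
      using Xz[of y] y2 y0 m unfolding npw by (auto simp: c_def X_def)
    also have "\<dots> = 16 * m * r powr (- k) * FF y"
      using y2 by (simp add: FF_def)
    finally show ?thesis
      using 1 y2 by (simp add: F_def H_def N_def)
  qed
  have pt: "F y * K y \<le> H y * K y - ?l * G y" for y
  proof (cases "x0 + y \<in> cbox a b")
    case True
    then have b: "x0 + y \<in> ball 0 (r / 2)" using box by blast
    then have br: "x0 + y \<in> ball 0 r" using r by auto
    define \<gamma> where "\<gamma> = f x0 + m * (bump r x0 - bump r (x0 + y)) - f (x0 + y)"
    have \<gamma>: "0 \<le> \<gamma>" "g (x0 + y) \<le> \<gamma>" using upper[OF br] fg[OF True] by (auto simp: \<gamma>_def)
    \<comment> \<open>the kernel has no positive lower bound at 0, but there the lower bound \<open>g\<close> of the gap is nonpositive\<close>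
    show ?thesis
    proof (cases "y = 0")
      case y: True
      have "F y = 0" by (simp add: F_def c_def y)
      moreover have "0 \<le> H y * K y" using Kp by (simp add: H_def N_def FF_def TT_def y)
      moreover have "?l * g (x0 + y) \<le> 0" using \<gamma>(2) l by (intro mult_nonneg_nonpos) (auto simp: \<gamma>_def y)
      ultimately show ?thesis using True by (simp add: G_def)
    next
      case False
      have "norm y \<le> norm (x0 + y) + norm x0"
        using norm_triangle_ineq4[of "x0 + y" x0] by simp
      then have "?l \<le> K y"
        using b x0 by (intro kernel_lower_bound[OF K \<rho> l False _ s(1)]) auto
      then have "?l * \<gamma> \<le> K y * \<gamma>" using \<gamma>(1) by (intro mult_right_mono)
      moreover have "?l * g (x0 + y) \<le> ?l * \<gamma>" using \<gamma>(2) l by (intro mult_left_mono) auto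
      moreover have "F y \<le> H y - \<gamma>" using in_ball[OF br] by (simp add: F_def \<gamma>_def)
      then have "F y * K y \<le> (H y - \<gamma>) * K y" using Kp by (rule mult_right_mono)
      ultimately show ?thesis using True by (simp add: G_def algebra_simps)
    qed
  next
    case False
    have "F y \<le> H y"
      using out_ball[of y] in_ball[of y] upper[of "x0 + y"]
      by (cases "x0 + y \<in> ball 0 r") (auto simp: F_def)
    then show ?thesis using False Kp[of y] by (simp add: G_def mult_right_mono)
  qed
  note G = shifted_box_integral[OF g, of x0, folded G_def]
  have "Lop s K f x0 = (\<integral>y. F y * K y - cor y * K y \<partial>lebesgue)"
    unfolding Lop_def delta_eq by (simp add: left_diff_distrib)
  also have "\<dots> = (\<integral>y. F y * K y \<partial>lebesgue) - (\<integral>y. cor y * K y \<partial>lebesgue)"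
    using int_F int_cor by (rule Bochner_Integration.integral_diff)
  also have "(\<integral>y. F y * K y \<partial>lebesgue) \<le> (\<integral>y. H y * K y - ?l * G y \<partial>lebesgue)"
    using int_F int_H G(1) pt by (intro integral_mono Bochner_Integration.integrable_diff integrable_mult_right) auto
  also have "\<dots> = (\<integral>y. H y * K y \<partial>lebesgue) - ?l * integral (cbox a b) g"
    using int_H G by (subst Bochner_Integration.integral_diff) auto
  finally have "Lop s K f x0 \<le> (\<integral>y. H y * K y \<partial>lebesgue) - ?l * integral (cbox a b) g
      - (\<integral>y. cor y * K y \<partial>lebesgue)" by simp
  then show ?thesis using H_bd cor_bd by (simp add: algebra_simps)
qed

section \<open>The accumulated deficit\<close>

text \<open>
  A box, not a ball: gauge integrals over boxes depend continuously on parameters, and the volume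
  is elementary.
\<close>

definition avg_box :: "real \<Rightarrow> 'a::euclidean_space set" where
  "avg_box r = cbox (- ((r / (4 * real DIM('a))) *\<^sub>R One)) ((r / (4 * real DIM('a))) *\<^sub>R One)"

lemma avg_box_subset:
  assumes "0 < r"
  shows "(avg_box r :: 'a::euclidean_space set) \<subseteq> cball 0 (r / 4)"
proof
  fix x :: 'a assume "x \<in> avg_box r"
  then have "\<bar>x \<bullet> b\<bar> \<le> r / (4 * real DIM('a))" if "b \<in> Basis" for b
    using that unfolding avg_box_def mem_box by (auto simp: abs_le_iff minus_le_iff)
  then have "(\<Sum>b\<in>Basis. \<bar>x \<bullet> b\<bar>) \<le> (\<Sum>b\<in>(Basis::'a set). r / (4 * real DIM('a)))"
    by (intro sum_mono)
  also have "\<dots> = r / 4" by simp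
  finally show "x \<in> cball 0 (r / 4)"
    using norm_le_l1[of x] by simp
qed

lemma content_avg_box:
  assumes "0 < r"
  shows "measure lborel (avg_box r :: 'a::euclidean_space set) = (1 / (2 * real DIM('a))) ^ DIM('a) * r ^ DIM('a)"
proof -
  have "measure lborel (avg_box r :: 'a set) = (\<Prod>b\<in>(Basis::'a set). r / (2 * real DIM('a)))"
    unfolding avg_box_def using assms
    by (subst content_cbox) (auto intro!: prod.cong simp: field_simps)
  then show ?thesis by (simp add: power_divide)
qed

text \<open>
  How far \<open>u\<close> stays below \<open>S\<close> on the box, weighted with the lower bound of the kernels at scale \<open>r\<close>.
  This is the part of the nonlocal diffusion on which the improvement rests.
\<close>

definition deficit_rate ::
  "real \<Rightarrow> real \<Rightarrow> real \<Rightarrow> real \<Rightarrow> ('a::euclidean_space \<times> real \<Rightarrow> real) \<Rightarrow> real \<Rightarrow> real" where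
  "deficit_rate s l r S u \<tau> = l * r powr (- real DIM('a) - 2 * s) * integral (avg_box r) (\<lambda>x. S - u (x, \<tau>))"

definition deficit ::
  "real \<Rightarrow> real \<Rightarrow> real \<Rightarrow> real \<Rightarrow> real \<Rightarrow> ('a::euclidean_space \<times> real \<Rightarrow> real) \<Rightarrow> real \<Rightarrow> real" where
  "deficit s l r T S u t = integral {- T..t} (deficit_rate s l r S u)"

lemma box_mass:
  assumes "0 < r" "cd = (1 / (2 * real DIM('a))) ^ DIM('a)"
  shows "l * r powr (- real DIM('a) - 2 * s) * measure lborel (avg_box r :: 'a::euclidean_space set) = l * cd * r powr (- 2 * s)"
proof -
  have "r powr (- real DIM('a) - 2 * s) * r ^ DIM('a) = r powr (- 2 * s)"
    using assms(1) by (simp add: powr_realpow[symmetric] powr_add[symmetric])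
  then show ?thesis using assms by (simp add: content_avg_box mult_ac)
qed

context
  fixes s l r S T \<omega> :: real and u :: "'a::euclidean_space \<times> real \<Rightarrow> real" and cd :: real
  assumes r: "0 < r" and l: "0 < l" and T: "0 < T" "T < r powr (2 * s)"
    and cont: "continuous_on (par_cyl s r) u"
    and up: "\<And>p. p \<in> par_cyl s r \<Longrightarrow> u p \<le> S" and low: "\<And>p. p \<in> par_cyl s r \<Longrightarrow> S - \<omega> \<le> u p"
    and cd: "cd = (1 / (2 * real DIM('a))) ^ DIM('a)"
begin

lemma slab_in_cyl: "norm x < r \<Longrightarrow> - T \<le> t \<Longrightarrow> t \<le> 0 \<Longrightarrow> (x, t) \<in> par_cyl s r"
  using T by (auto simp: par_cyl_def time_int_def)

lemma box_in_cyl: "x \<in> avg_box r \<Longrightarrow> - T \<le> t \<Longrightarrow> t \<le> 0 \<Longrightarrow> (x, t) \<in> par_cyl s r"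
  using avg_box_subset[OF r] r by (intro slab_in_cyl) (auto dest!: subsetD)

lemma slice_continuous:
  assumes "- T \<le> t" "t \<le> 0"
  shows "continuous_on (ball 0 r) (\<lambda>x. u (x, t))"
  by (rule continuous_on_compose2[OF cont]) (use assms slab_in_cyl in \<open>auto intro!: continuous_intros\<close>)

lemma box_slice_continuous:
  assumes "- T \<le> t" "t \<le> 0"
  shows "continuous_on (avg_box r) (\<lambda>x. u (x, t))"
  by (rule continuous_on_compose2[OF cont]) (use assms box_in_cyl in \<open>auto intro!: continuous_intros\<close>)

lemma box_slice_integrable:
  assumes "- T \<le> t" "t \<le> 0"
  shows "(\<lambda>x. u (x, t)) integrable_on avg_box r"
  using box_slice_continuous[OF assms] unfolding avg_box_def by (rule integrable_continuous)

lemma deficit_rate_continuous: "continuous_on {- T..0} (deficit_rate s l r S u)"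
proof -
  have "continuous_on {- T..0} (\<lambda>\<tau>. integral (avg_box r) (\<lambda>x. S - u (x, \<tau>)))"
    unfolding avg_box_def
  proof (rule integral_continuous_on_param)
    show "continuous_on ({- T..0} \<times> cbox (- ((r / (4 * real DIM('a))) *\<^sub>R One)) ((r / (4 * real DIM('a))) *\<^sub>R One))
        (\<lambda>(\<tau>, x). S - u (x, \<tau>))"
      unfolding case_prod_beta
      by (intro continuous_on_diff continuous_on_const continuous_on_compose2[OF cont] continuous_intros)
        (auto intro!: box_in_cyl simp: avg_box_def)
  qed
  then show ?thesis
    unfolding deficit_rate_def by (intro continuous_on_mult continuous_on_const)
qed

lemma deficit_rate_bounds:
  assumes t: "- T \<le> t" "t \<le> 0"
  shows "0 \<le> deficit_rate s l r S u t" "deficit_rate s l r S u t \<le> l * cd * \<omega> * r powr (- 2 * s)"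
proof -
  have i: "(\<lambda>x. S - u (x, t)) integrable_on avg_box r"
    using box_slice_integrable[OF t] by (intro integrable_diff) (auto simp: avg_box_def)
  have "0 \<le> integral (avg_box r) (\<lambda>x. S - u (x, t))"
    using up box_in_cyl t by (intro integral_nonneg i) auto
  then show "0 \<le> deficit_rate s l r S u t" using l by (simp add: deficit_rate_def)
  have "integral (avg_box r) (\<lambda>x. S - u (x, t)) \<le> integral (avg_box r) (\<lambda>x::'a. \<omega>)"
    using low box_in_cyl t by (intro integral_le i) (auto simp: avg_box_def algebra_simps)
  also have "\<dots> = measure lborel (avg_box r :: 'a set) * \<omega>" by (simp add: avg_box_def)
  finally have "deficit_rate s l r S u t \<le> l * r powr (- real DIM('a) - 2 * s) * (measure lborel (avg_box r :: 'a set) * \<omega>)"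
    unfolding deficit_rate_def using l by (intro mult_left_mono) auto
  also have "\<dots> = l * cd * \<omega> * r powr (- 2 * s)"
    using box_mass[OF r cd, of l s] by (simp add: mult_ac)
  finally show "deficit_rate s l r S u t \<le> l * cd * \<omega> * r powr (- 2 * s)" .
qed

lemma deficit_rate_integrable: "- T \<le> a \<Longrightarrow> b \<le> 0 \<Longrightarrow> deficit_rate s l r S u integrable_on {a..b}"
  using deficit_rate_continuous
  by (intro integrable_continuous_real) (auto intro: continuous_on_subset)

lemma deficit_derivative:
  assumes "- T \<le> t" "t \<le> 0"
  shows "(deficit s l r T S u has_vector_derivative deficit_rate s l r S u t) (at t within {- T..0})"
  unfolding deficit_def using integral_has_vector_derivative[OF deficit_rate_continuous, of t] assms by auto

lemma deficit_mono:
  assumes "- T \<le> t" "t \<le> t'" "t' \<le> 0"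
  shows "deficit s l r T S u t \<le> deficit s l r T S u t'"
proof -
  have "deficit s l r T S u t' = deficit s l r T S u t + integral {t..t'} (deficit_rate s l r S u)"
    unfolding deficit_def using assms
    by (intro Henstock_Kurzweil_Integration.integral_combine[symmetric] deficit_rate_integrable) auto
  moreover have "0 \<le> integral {t..t'} (deficit_rate s l r S u)"
    using assms deficit_rate_bounds(1) by (intro integral_nonneg deficit_rate_integrable) auto
  ultimately show ?thesis by simp
qed

lemma deficit_bounds:
  assumes "- T \<le> t" "t \<le> 0"
  shows "0 \<le> deficit s l r T S u t" "deficit s l r T S u t \<le> l * cd * \<omega> * r powr (- 2 * s) * T"
proof -
  have "deficit s l r T S u (- T) = 0" by (simp add: deficit_def)
  then show "0 \<le> deficit s l r T S u t" using deficit_mono[of "- T" t] assms by simp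
  have "deficit s l r T S u t \<le> deficit s l r T S u 0" using deficit_mono[of t 0] assms by simp
  also have "\<dots> \<le> integral {- T..0} (\<lambda>_. l * cd * \<omega> * r powr (- 2 * s))"
    unfolding deficit_def using deficit_rate_bounds(2)
    by (intro integral_le deficit_rate_integrable) auto
  also have "\<dots> = l * cd * \<omega> * r powr (- 2 * s) * T" using T by simp
  finally show "deficit s l r T S u t \<le> l * cd * \<omega> * r powr (- 2 * s) * T" .
qed

lemma deficit_continuous: "continuous_on {- T..0} (deficit s l r T S u)"
  unfolding deficit_def by (intro indefinite_integral_continuous_1 deficit_rate_integrable) auto

end

section \<open>Improving one bound\<close>

lemma slice_measurable:
  fixes u :: "'a::euclidean_space \<times> real \<Rightarrow> real"
  assumes "u \<in> bdd_borel I" "t \<in> I"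
  shows "(\<lambda>x. u (x, t)) \<in> borel_measurable borel"
proof -
  have u: "u \<in> borel_measurable (restrict_space borel (UNIV \<times> I))"
    using assms(1) by (simp add: bdd_borel_def)
  have "(\<lambda>x::'a. (x, t)) \<in> borel \<rightarrow>\<^sub>M restrict_space borel (UNIV \<times> I)"
    using assms(2) by (intro measurable_restrict_space2) auto
  then show ?thesis by (rule measurable_compose[OF _ u])
qed

lemma bump_le_1: "bump r x \<le> 1"
  by (simp add: bump_def)

lemma bump_nonpos: "0 < r \<Longrightarrow> r / 2 \<le> norm x \<Longrightarrow> bump r x \<le> 0"
  using power_mono[of "r / 2" "norm x" 2] by (simp add: bump_def power_divide field_simps)

lemma continuous_on_bump [continuous_intros]: "continuous_on A (bump r)"
  unfolding bump_def by (cases "r = 0") (auto intro!: continuous_intros)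

lemma test_fun_barrier:
  fixes x0 x :: "'a::euclidean_space"
  assumes md: "\<And>t. t \<in> {t0 - e<..t0} \<Longrightarrow> (m has_vector_derivative m' t) (at_left t)"
  shows "test_fun x0 t0 e (\<lambda>(x, t). W - m t * bump r x + E * (t + T))"
    and "t \<in> {t0 - e<..t0} \<Longrightarrow>
      ((\<lambda>\<tau>. W - m \<tau> * bump r x + E * (\<tau> + T)) has_vector_derivative (E - m' t * bump r x)) (at_left t)"
    and "GDERIV (\<lambda>x. W - m t * bump r x + E * (t + T)) x :> (8 * m t / r\<^sup>2) *\<^sub>R x"
proof -
  have d: "((\<lambda>\<tau>. W - m \<tau> * bump r x + E * (\<tau> + T)) has_vector_derivative (E - m' t * bump r x)) (at_left t)"
    if "t \<in> {t0 - e<..t0}" for t and x :: 'a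
    using md[OF that]
    by (auto intro!: derivative_eq_intros simp: has_real_derivative_iff_has_vector_derivative[symmetric])
  have G: "GDERIV (\<lambda>x. W - m t * bump r x + E * (t + T)) x :> (8 * m t / r\<^sup>2) *\<^sub>R x" for t and x :: 'a
    using GDERIV_bump_affine[of "W + E * (t + T)" "m t" r x] by (simp add: algebra_simps)
  have "C11_on (ball x0 e) (\<lambda>x. W - m t * bump r x + E * (t + T))" for t
    unfolding C11_on_def
  proof (intro exI conjI ballI)
    show "GDERIV (\<lambda>x. W - m t * bump r x + E * (t + T)) x :> (8 * m t / r\<^sup>2) *\<^sub>R x" for x :: 'a by (rule G)
    show "\<bar>8 * m t / r\<^sup>2\<bar>-lipschitz_on (ball x0 e) (\<lambda>x. (8 * m t / r\<^sup>2) *\<^sub>R x)"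
      by (auto simp: lipschitz_on_def dist_norm scaleR_diff_right[symmetric])
  qed
  then show "test_fun x0 t0 e (\<lambda>(x, t). W - m t * bump r x + E * (t + T))"
    using d unfolding test_fun_def by (auto intro!: differentiableI_vector[OF d])
  show "t \<in> {t0 - e<..t0} \<Longrightarrow>
      ((\<lambda>\<tau>. W - m \<tau> * bump r x + E * (\<tau> + T)) has_vector_derivative (E - m' t * bump r x)) (at_left t)"
    by (rule d)
  show "GDERIV (\<lambda>x. W - m t * bump r x + E * (t + T)) x :> (8 * m t / r\<^sup>2) *\<^sub>R x" by (rule G)
qed

text \<open>
  If the claim failed, \<open>u + m b - E (t + T)\<close> would have a maximum \<open>W > S\<close> over the compact slab. It is
  attained at a time later than \<open>-T\<close>, because \<open>m(-T) = 0\<close>, and in the interior in space, because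
  \<open>b \<le> 0\<close> on the lateral boundary. The barrier through this maximum is a test function. In the resulting inequality
  the deficit rate cancels between the time derivative and the nonlocal gain, and the definition of
  \<open>E\<close> leaves a contradiction.
\<close>

lemma one_sided_improvement:
  fixes u :: "'a::euclidean_space \<times> real \<Rightarrow> real"
  assumes s: "0 < s" "s < 1" and l: "0 < l" and L: "0 < L" and D: "0 \<le> D" "D * r powr (2 * s - 1) \<le> D'"
    and A: "0 \<le> A" and sub: "subsolution s l L \<rho> D A R u" and \<rho>: "0 \<le> \<rho>" "\<rho> \<le> r" and r: "0 < r" "r \<le> R"
    and h: "0 < h" "h < 1" and \<omega>: "0 < \<omega>" and \<epsilon>: "0 \<le> \<epsilon>"
    and up: "\<And>p. p \<in> par_cyl s r \<Longrightarrow> u p \<le> S" and low: "\<And>p. p \<in> par_cyl s r \<Longrightarrow> S - \<omega> \<le> u p"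
    and tail: "\<And>x t. t \<in> time_int s r \<Longrightarrow> r \<le> norm x \<Longrightarrow> u (x, t) \<le> S + \<epsilon> * \<omega> * (norm x / r) powr s"
    and cd: "cd = (1 / (2 * real DIM('a))) ^ DIM('a)" and T: "T = h * r powr (2 * s)"
    and C: "C = diffusion_const s * L + l * cd + 4 * D'"
    and E: "E = A + r powr (- 2 * s) * \<omega> * (2 * C * (l * cd) * h + tail_const s * L * \<epsilon>)"
    and x: "norm x \<le> r / 2" and t: "- T \<le> t" "t \<le> 0"
  shows "u (x, t) \<le> S - deficit s l r T S u t * bump r x + E * (t + T)"
proof -
  define m where "m = deficit s l r T S u"
  define a where "a = deficit_rate s l r S u"
  define \<nu> where "\<nu> = r powr (- 2 * s)"
  have \<nu>: "0 < \<nu>" using r by (simp add: \<nu>_def)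
  have \<nu>': "\<nu> * r powr (2 * s) = 1" using r by (simp add: \<nu>_def powr_add[symmetric])
  have cd0: "0 < cd" by (simp add: cd)
  have D'0: "0 \<le> D'" using D by (meson mult_nonneg_nonneg order_trans powr_ge_zero)
  have C0: "0 < C" using diffusion_const_pos[OF s] L l cd0 D'0 by (simp add: C add_pos_nonneg)
  have E0: "0 \<le> E"
    unfolding E using A \<omega> C0 l cd0 h tail_const_pos[OF s(1)] L \<epsilon> by (intro add_nonneg_nonneg mult_nonneg_nonneg) auto
  have T0: "0 < T" "T < r powr (2 * s)" using h r by (auto simp: T)
  have rR: "r powr (2 * s) \<le> R powr (2 * s)" using r s by (intro powr_mono2) auto
  have cyl: "par_cyl s r \<subseteq> par_cyl s R" "time_int s r \<subseteq> time_int s R"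
    using rR r by (auto simp: par_cyl_def time_int_def)
  have cont: "continuous_on (par_cyl s r) u"
    using sub cyl by (auto simp: subsolution_def intro: continuous_on_subset)
  note ctx = r(1) l T0 cont up low cd
  have mle: "m t \<le> l * cd * h * \<omega>" "0 \<le> m t" if "- T \<le> t" "t \<le> 0" for t
  proof -
    have "m t \<le> l * cd * \<omega> * \<nu> * T"
      unfolding m_def \<nu>_def using deficit_bounds(2)[OF ctx that] .
    also have "\<dots> = l * cd * h * \<omega> * (\<nu> * r powr (2 * s))" by (simp add: T)
    finally show "m t \<le> l * cd * h * \<omega>" by (simp add: \<nu>')
    show "0 \<le> m t" unfolding m_def using deficit_bounds(1)[OF ctx that] .
  qed
  have mT: "m (- T) = 0" by (simp add: m_def deficit_def)
  define w where "w = (\<lambda>p. u p + m (snd p) * bump r (fst p) - E * (snd p + T))"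
  define Z where "Z = cball (0::'a) (r / 2) \<times> {- T..0}"
  have slab: "(x, t) \<in> par_cyl s r" if "norm x < r" "- T \<le> t" "t \<le> 0" for x :: 'a and t
    using slab_in_cyl[OF ctx that] .
  have Z1: "compact Z" unfolding Z_def by (intro compact_Times) auto
  have Z2: "Z \<noteq> {}" using r T0 by (auto simp: Z_def)
  have Z3: "continuous_on Z w"
  proof -
    have "continuous_on Z u" using slab r by (intro continuous_on_subset[OF cont]) (auto simp: Z_def)
    moreover have "continuous_on Z (\<lambda>p. m (snd p))"
      unfolding m_def by (rule continuous_on_compose2[OF deficit_continuous[OF ctx]]) (auto simp: Z_def intro!: continuous_intros)
    moreover have "continuous_on Z (\<lambda>p. bump r (fst p))"
      by (rule continuous_on_compose2[OF continuous_on_bump[of UNIV]]) (auto intro!: continuous_intros)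
    ultimately show ?thesis unfolding w_def by (intro continuous_intros)
  qed
  from continuous_attains_sup[OF Z1 Z2 Z3]
  obtain p0 where p0: "p0 \<in> Z" and max: "\<And>p. p \<in> Z \<Longrightarrow> w p \<le> w p0" by blast
  obtain x0 t0 where p0_eq: "p0 = (x0, t0)" by (cases p0)
  define W where "W = w (x0, t0)"
  have "W \<le> S"
  proof (rule ccontr)
    assume "\<not> W \<le> S"
    then have WS: "S < W" by simp
    have x0: "norm x0 \<le> r / 2" and t0: "- T \<le> t0" "t0 \<le> 0" using p0 by (auto simp: p0_eq Z_def)
    have Et0: "0 \<le> E * (t0 + T)" using E0 t0 by auto
    have u_le: "u (x0, t0) \<le> S" using x0 t0 r by (intro up slab) auto
    have W_eq: "W = u (x0, t0) + m t0 * bump r x0 - E * (t0 + T)" by (simp add: W_def w_def)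
    have mb: "0 < m t0 * bump r x0" using WS u_le W_eq Et0 by linarith
    then have t0': "- T < t0" using t0 mT by (cases "t0 = - T") auto
    have x0': "norm x0 < r / 2"
    proof (rule ccontr)
      assume "\<not> norm x0 < r / 2"
      then have "bump r x0 \<le> 0" using r by (intro bump_nonpos) auto
      then show False using mb mle(2)[OF t0] by (simp add: zero_less_mult_iff)
    qed
    define mm where "mm = m t0"
    have mm: "0 \<le> mm" "mm \<le> l * cd * h * \<omega>" using mle t0 by (auto simp: mm_def)
    define \<psi> where "\<psi> = (\<lambda>x::'a. W - mm * bump r x + E * (t0 + T))"
    \<comment> \<open>\<open>f\<close> coincides with the barrier near the touching point, so the gap is lost there; by
      continuity of \<open>u\<close> the loss is at most \<open>\<sigma>\<close>, which is small enough to keep the final inequality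
      strict\<close>
    define \<sigma> where "\<sigma> = C * h * \<omega> / 2"
    have \<sigma>: "0 < \<sigma>" using C0 h \<omega> by (simp add: \<sigma>_def)
    have \<psi>0: "\<psi> x0 = u (x0, t0)" by (simp add: \<psi>_def W_eq mm_def)
    have \<psi>_ge: "S - mm \<le> \<psi> x" for x :: 'a
      using mult_left_mono[OF bump_le_1[of r x] mm(1)] WS Et0 by (simp add: \<psi>_def)
    have \<psi>_bound: "u (x, t0) \<le> \<psi> x" if "norm x < r" for x
    proof (cases "norm x \<le> r / 2")
      case True
      then have "w (x, t0) \<le> W" using max[of "(x, t0)"] t0 by (simp add: Z_def W_def p0_eq)
      then show ?thesis by (simp add: w_def \<psi>_def mm_def)
    next
      case False
      then have "bump r x \<le> 0" using r by (intro bump_nonpos) auto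
      then have "mm * bump r x \<le> 0" using mm by (simp add: mult_nonneg_nonpos)
      moreover have "u (x, t0) \<le> S" using that t0 by (intro up slab) auto
      ultimately show ?thesis using WS Et0 by (simp add: \<psi>_def)
    qed
    have "\<exists>\<delta>>0. \<forall>x. dist x x0 < \<delta> \<longrightarrow> \<psi> x < u (x, t0) + \<sigma>"
    proof -
      have "continuous_on (ball 0 r) (\<lambda>x. \<psi> x - u (x, t0))"
        unfolding \<psi>_def using slice_continuous[OF ctx t0] by (intro continuous_intros)
      then have "isCont (\<lambda>x. \<psi> x - u (x, t0)) x0"
        using x0 r by (subst (asm) continuous_on_eq_continuous_at) auto
      then show ?thesis
        using \<sigma> \<psi>0 unfolding continuous_at_eps_delta
        by (elim allE[of _ \<sigma>]) (auto simp: dist_real_def abs_less_iff algebra_simps)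
    qed
    then obtain \<delta> where \<delta>: "0 < \<delta>" "\<And>x. dist x x0 < \<delta> \<Longrightarrow> \<psi> x < u (x, t0) + \<sigma>" by blast
    define e where "e = min \<delta> (min (t0 + T) (r / 2 - norm x0))"
    have e: "0 < e" "e \<le> \<delta>" "e \<le> t0 + T" "e \<le> r / 2 - norm x0" using \<delta> t0' x0' by (auto simp: e_def)
    have e_ball: "norm x < r / 2" if "x \<in> ball x0 e" for x
    proof -
      have "norm x \<le> norm x0 + norm (x - x0)" using norm_triangle_ineq[of x0 "x - x0"] by simp
      then show ?thesis using that e by (auto simp: dist_norm norm_minus_commute)
    qed
    define \<phi> where "\<phi> = (\<lambda>(x::'a, t). W - m t * bump r x + E * (t + T))"
    let ?B = "back_cyl x0 t0 e"
    define v where "v = glue ?B \<phi> u"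
    define f where "f = (\<lambda>x. v (x, t0))"
    have slab_B: "norm x < r / 2 \<and> - T \<le> t \<and> t \<le> 0" if "(x, t) \<in> ?B" for x t
      using that e t0 e_ball[of x] unfolding back_cyl_def by auto
    have B_Z: "?B \<subseteq> Z" using slab_B by (auto simp: Z_def less_imp_le)
    have B_cyl: "?B \<subseteq> ball 0 R \<times> time_int s R"
    proof
      fix p assume "p \<in> ?B"
      moreover obtain x t where p: "p = (x, t)" by (cases p)
      ultimately have "(x, t) \<in> par_cyl s r" using slab_B[of x t] r by (intro slab) auto
      then show "p \<in> ball 0 R \<times> time_int s R" using cyl unfolding p par_cyl_def[of s R] by blast
    qed
    have touch: "u p \<le> \<phi> p" if "p \<in> ?B" for p
    proof -
      have "w p \<le> W" using max[of p] that B_Z by (auto simp: W_def p0_eq)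
      then show ?thesis by (cases p) (simp add: \<phi>_def w_def)
    qed
    have at0: "u (x0, t0) = \<phi> (x0, t0)" by (simp add: \<phi>_def W_eq)
    have md: "(m has_vector_derivative a t) (at_left t)" if "t \<in> {t0 - e<..t0}" for t
    proof -
      have t: "- T < t" "t \<le> 0" using that e t0 by auto
      have "(m has_vector_derivative a t) (at t within {- T..0})"
        unfolding m_def a_def using deficit_derivative[OF ctx, of t] t by simp
      then have "(m has_vector_derivative a t) (at t within {- T..<t})"
        using t by (rule_tac has_vector_derivative_within_subset) auto
      moreover have "at t within {- T..<t} = at_left t"
        using t by (intro at_within_nhd[of _ "{- T<..}"]) auto
      ultimately show ?thesis by simp
    qed
    note barrier = test_fun_barrier[of t0 e m a, OF md]
    have tf: "test_fun x0 t0 e \<phi>" unfolding \<phi>_def by (rule barrier(1))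
    have dt: "dt_left v x0 t0 = E - a t0 * bump r x0"
      unfolding v_def using barrier(2)[of t0 W r x0 E T] e(1)
      by (intro dt_left_glue) (auto simp: \<phi>_def)
    have "GDERIV f x0 :> (8 * mm / r\<^sup>2) *\<^sub>R x0"
      unfolding f_def v_def mm_def using barrier(3)[of W t0 r E T x0] e(1)
      by (intro GDERIV_glue) (auto simp: \<phi>_def)
    then have gr: "grad f x0 = (8 * mm / r\<^sup>2) *\<^sub>R x0" by (rule grad_eqI)
    have f_in: "f x = \<psi> x" if "x \<in> ball x0 e" for x
      using that e(1) by (auto simp: f_def v_def glue_def back_cyl_def \<phi>_def \<psi>_def mm_def)
    have f_out: "f x = u (x, t0)" if "x \<notin> ball x0 e" for x
      using that by (auto simp: f_def v_def glue_def back_cyl_def)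
    have f0: "f x0 = \<psi> x0" using f_in[of x0] e by auto
    have \<psi>_diff: "f x0 + mm * (bump r x0 - bump r x) = \<psi> x" for x
      by (simp add: f0 \<psi>_def algebra_simps)
    have t0r: "t0 \<in> time_int s r" using t0 T0 by (auto simp: time_int_def)
    have ub: "u \<in> bdd_borel (time_int s R)" using sub by (simp add: subsolution_def)
    have t0R: "t0 \<in> time_int s R" using t0r cyl by blast
    have "bounded (u ` (UNIV \<times> time_int s R))" using ub by (simp add: bdd_borel_def)
    then obtain B where "\<And>y. y \<in> u ` (UNIV \<times> time_int s R) \<Longrightarrow> norm y \<le> B"
      unfolding bounded_iff by blast
    then have B: "\<bar>u (x, t0)\<bar> \<le> B" for x using t0R by force
    have fm: "f \<in> borel_measurable borel"
    proof -
      have "f = (\<lambda>x. if x \<in> ball x0 e then \<psi> x else u (x, t0))" using f_in f_out by auto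
      moreover have "\<psi> \<in> borel_measurable borel"
        unfolding \<psi>_def by (intro borel_measurable_continuous_onI continuous_intros)
      moreover have "(\<lambda>x. u (x, t0)) \<in> borel_measurable borel"
        using slice_measurable[OF ub t0R] .
      ultimately show ?thesis by (auto intro!: measurable_If_set)
    qed
    have fB: "\<bar>f x\<bar> \<le> B + \<sigma>" for x
    proof (cases "x \<in> ball x0 e")
      case True
      then have "\<psi> x < u (x, t0) + \<sigma>" using e by (intro \<delta>) (auto simp: dist_commute)
      moreover have "u (x, t0) \<le> \<psi> x" using e_ball[OF True] r by (intro \<psi>_bound) auto
      ultimately show ?thesis using B[of x] f_in[OF True] by linarith
    qed (use B[of x] f_out \<sigma> in auto)
    define g where "g = (\<lambda>x. S - u (x, t0) - (mm + \<sigma>))"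
    have box_in: "x \<in> ball 0 (r / 2)" if "x \<in> avg_box r" for x :: 'a
      using that avg_box_subset[OF r(1)] r(1) by fastforce
    have c: "Lop s K f x0 \<le> diffusion_const s * L * mm * \<nu> + tail_const s * L * (\<epsilon> * \<omega>) * \<nu>
           - l * r powr (- real DIM('a) - 2 * s) * integral (avg_box r) g" if K: "K \<in> kernels s l L \<rho>" for K
      unfolding \<nu>_def avg_box_def
    proof (rule Lop_upper_bound[OF s K \<rho> r(1) _ _ x0' mm(1) _ fm fB e(1)])
      show "0 \<le> l" "0 \<le> L" "0 \<le> \<epsilon> * \<omega>" using l L \<epsilon> \<omega> by auto
      show "f x = f x0 + mm * (bump r x0 - bump r x)" if "x \<in> ball x0 e" for x
        unfolding \<psi>_diff using f_in that by auto
      show "f x \<le> f x0 + mm * (bump r x0 - bump r x)" if "x \<in> ball 0 r" for x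
        unfolding \<psi>_diff using f_in f_out[of x] \<psi>_bound[of x] that by (cases "x \<in> ball x0 e") auto
      show "f x \<le> f x0 + mm + \<epsilon> * \<omega> * (norm x / r) powr s" if "x \<notin> ball 0 r" for x
      proof -
        have "x \<notin> ball x0 e" using e_ball[of x] that r by auto
        then have "f x = u (x, t0)" by (rule f_out)
        also have "\<dots> \<le> S + \<epsilon> * \<omega> * (norm x / r) powr s" using that by (intro tail t0r) auto
        finally show ?thesis using \<psi>_ge[of x0] f0 by linarith
      qed
      show "cbox (- ((r / (4 * real DIM('a))) *\<^sub>R One)) ((r / (4 * real DIM('a))) *\<^sub>R One) \<subseteq> ball (0::'a) (r / 2)"
        using box_in unfolding avg_box_def by blast
      show "continuous_on (cbox (- ((r / (4 * real DIM('a))) *\<^sub>R One)) ((r / (4 * real DIM('a))) *\<^sub>R One)) g"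
        using box_slice_continuous[OF ctx t0] unfolding avg_box_def g_def by (intro continuous_intros)
      show "f x + g x \<le> f x0 + mm * (bump r x0 - bump r x)"
        if x: "x \<in> cbox (- ((r / (4 * real DIM('a))) *\<^sub>R One)) ((r / (4 * real DIM('a))) *\<^sub>R One)" for x
      proof -
        have "f x \<le> u (x, t0) + \<sigma>"
          using \<delta>(2)[of x] f_in[of x] f_out[of x] e \<sigma> by (cases "x \<in> ball x0 e") (auto simp: dist_commute)
        then show ?thesis unfolding \<psi>_diff using \<psi>_ge[of x] by (simp add: g_def)
      qed
    qed
    have gain: "l * r powr (- real DIM('a) - 2 * s) * integral (avg_box r) g = a t0 - l * cd * \<nu> * (mm + \<sigma>)"
    proof -
      have "integral (avg_box r) g = integral (avg_box r) (\<lambda>x. S - u (x, t0)) - integral (avg_box r) (\<lambda>x::'a. mm + \<sigma>)"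
        unfolding g_def using box_slice_integrable[OF ctx t0]
        by (intro Henstock_Kurzweil_Integration.integral_diff integrable_diff) (auto simp: avg_box_def)
      also have "integral (avg_box r) (\<lambda>x::'a. mm + \<sigma>) = measure lborel (avg_box r :: 'a set) * (mm + \<sigma>)"
        by (simp add: avg_box_def)
      finally have I: "integral (avg_box r) g
          = integral (avg_box r) (\<lambda>x. S - u (x, t0)) - measure lborel (avg_box r :: 'a set) * (mm + \<sigma>)" .
      have "l * r powr (- real DIM('a) - 2 * s) * integral (avg_box r) g
          = a t0 - (l * r powr (- real DIM('a) - 2 * s) * measure lborel (avg_box r :: 'a set)) * (mm + \<sigma>)"
        unfolding I a_def deficit_rate_def by (simp add: algebra_simps)
      then show ?thesis unfolding box_mass[OF r(1) cd] \<nu>_def .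
    qed
    have "dt_left v x0 t0 \<le> A + (diffusion_const s * L * mm * \<nu> + tail_const s * L * (\<epsilon> * \<omega>) * \<nu>
           - (a t0 - l * cd * \<nu> * (mm + \<sigma>))) + D * norm (grad f x0)"
    proof -
      have "(x0, t0) \<in> ?B" using e(1) by (auto simp: back_cyl_def)
      then have "(x0, t0) \<in> ball 0 R \<times> time_int s R" using B_cyl by blast
      then have "(x0, t0) \<in> ball 0 R \<times> time_int s R \<and> 0 < e \<and> ?B \<subseteq> ball 0 R \<times> time_int s R \<and>
          test_fun x0 t0 e \<phi> \<and> u (x0, t0) = \<phi> (x0, t0) \<and> (\<forall>p\<in>?B. u p \<le> \<phi> p) \<and>
          (\<forall>K\<in>kernels s l L \<rho>. Lop s K (\<lambda>x. glue ?B \<phi> u (x, t0)) x0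
             \<le> diffusion_const s * L * mm * \<nu> + tail_const s * L * (\<epsilon> * \<omega>) * \<nu>
               - (a t0 - l * cd * \<nu> * (mm + \<sigma>)))"
        using e(1) B_cyl tf at0 touch c[unfolded gain] unfolding f_def v_def by (intro conjI ballI) auto
      then show ?thesis
        using sub[unfolded subsolution_def, THEN conjunct2, THEN conjunct2, rule_format, of x0 t0 e \<phi>]
        unfolding f_def v_def by blast
    qed
    moreover have "D * norm (grad f x0) \<le> 4 * D' * mm * \<nu>"
    proof -
      have "norm (grad f x0) = 8 * mm / r\<^sup>2 * norm x0" using mm by (simp add: gr)
      also have "\<dots> \<le> 8 * mm / r\<^sup>2 * (r / 2)" using x0 mm by (intro mult_left_mono) auto
      also have "\<dots> = 4 * mm * (r powr (2 * s - 1) * \<nu>)"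
      proof -
        have "r powr (2 * s - 1) * \<nu> = inverse r"
          using r by (simp add: \<nu>_def powr_diff powr_minus field_simps)
        then show ?thesis using r by (simp add: power2_eq_square field_simps)
      qed
      finally have "D * norm (grad f x0) \<le> D * (4 * mm * (r powr (2 * s - 1) * \<nu>))"
        using D by (intro mult_left_mono)
      also have "\<dots> = (D * r powr (2 * s - 1)) * (4 * mm * \<nu>)" by (simp add: mult_ac)
      also have "\<dots> \<le> D' * (4 * mm * \<nu>)" using D mm \<nu> by (intro mult_right_mono) auto
      finally show ?thesis by (simp add: mult_ac)
    qed
    moreover have "a t0 * bump r x0 \<le> a t0"
      using mult_left_mono[OF bump_le_1[of r x0], of "a t0"] deficit_rate_bounds(1)[OF ctx t0] by (simp add: a_def)
    ultimately have "E \<le> A + \<nu> * (C * mm + tail_const s * L * \<epsilon> * \<omega> + l * cd * \<sigma>)"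
      unfolding dt C by (simp add: algebra_simps)
    also have "\<dots> \<le> A + \<nu> * (C * (l * cd * h * \<omega>) + tail_const s * L * \<epsilon> * \<omega> + l * cd * \<sigma>)"
    proof -
      have "C * mm \<le> C * (l * cd * h * \<omega>)" using mm C0 by (intro mult_left_mono) auto
      then show ?thesis using \<nu> by (intro add_left_mono mult_left_mono) auto
    qed
    also have "\<dots> = E - \<nu> * (l * cd * C * h * \<omega> / 2)"
      unfolding E \<sigma>_def \<nu>_def[symmetric] by (simp add: field_simps)
    finally have "\<nu> * (l * cd * C * h * \<omega> / 2) \<le> 0" by simp
    moreover have "0 < \<nu> * (l * cd * C * h * \<omega> / 2)" using \<nu> l cd0 C0 h \<omega> by simp
    ultimately show False by linarith
  qed
  moreover have "w (x, t) \<le> W" using max[of "(x, t)"] x t by (simp add: Z_def W_def p0_eq)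
  ultimately show ?thesis by (simp add: w_def m_def)
qed

section \<open>Decay of the oscillation\<close>

text \<open>
  Lower and upper improvements are taken at different times, but both deficits are nondecreasing,
  so each can be bounded below by its value at \<open>-T/2\<close>, where their sum is known exactly. The
  hypothesis \<open>tail\<close> compares with arbitrary values of \<open>u\<close> in the cylinder. As the oscillation is at least
  \<open>\<mu> \<omega>\<close> by \<open>big\<close>, it bounds the excess of \<open>u\<close> over its supremum, and below its infimum, by
  \<open>\<epsilon> \<omega> (|x|/r)\<^sup>s\<close>.
\<close>

lemma oscillation_step:
  fixes u :: "'a::euclidean_space \<times> real \<Rightarrow> real"
  assumes s: "0 < s" "s < 1" and l: "0 < l" and L: "0 < L" and D: "0 \<le> D" "D * r powr (2 * s - 1) \<le> D'"
    and A: "0 \<le> A" and sub: "subsolution s l L \<rho> D A R u" "subsolution s l L \<rho> D A R (\<lambda>p. - u p)"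
    and \<rho>: "0 \<le> \<rho>" "\<rho> \<le> r" and r: "0 < r" "r \<le> R"
    and h: "0 < h" "h < 1" and \<omega>: "0 < \<omega>" and \<epsilon>: "0 \<le> \<epsilon>" and \<mu>: "1 / 2 \<le> \<mu>"
    and osc: "\<And>p q. p \<in> par_cyl s r \<Longrightarrow> q \<in> par_cyl s r \<Longrightarrow> u p - u q \<le> \<omega>"
    and big: "p1 \<in> par_cyl s r" "q1 \<in> par_cyl s r" "\<mu> * \<omega> \<le> u p1 - u q1"
    and tail: "\<And>x t q. t \<in> time_int s r \<Longrightarrow> r \<le> norm x \<Longrightarrow> q \<in> par_cyl s r \<Longrightarrow>
        \<bar>u (x, t) - u q\<bar> \<le> \<mu> * \<omega> + \<epsilon> * \<omega> * (norm x / r) powr s"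
    and cd: "cd = (1 / (2 * real DIM('a))) ^ DIM('a)"
    and C: "C = diffusion_const s * L + l * cd + 4 * D'"
    and small: "C * h \<le> 1 / 128" "64 * tail_const s * L * \<epsilon> \<le> l * cd" "64 * A * r powr (2 * s) \<le> l * cd * \<omega>"
    and \<eta>: "0 < \<eta>" "\<eta> \<le> 1 / 4" "\<eta> powr (2 * s) \<le> h / 2"
    and p: "p \<in> par_cyl s (\<eta> * r)" and q: "q \<in> par_cyl s (\<eta> * r)"
  shows "u p - u q \<le> (1 - l * cd * h / 32) * \<omega>"
proof -
  define T where "T = h * r powr (2 * s)"
  define E where "E = A + r powr (- 2 * s) * \<omega> * (2 * C * (l * cd) * h + tail_const s * L * \<epsilon>)"
  define \<nu> where "\<nu> = r powr (- 2 * s)"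
  have \<nu>: "0 < \<nu>" using r by (simp add: \<nu>_def)
  have \<nu>': "\<nu> * r powr (2 * s) = 1" using r by (simp add: \<nu>_def powr_add[symmetric])
  have cd0: "0 < cd" by (simp add: cd)
  have D'0: "0 \<le> D'" using D by (meson mult_nonneg_nonneg order_trans powr_ge_zero)
  have C0: "0 < C" using diffusion_const_pos[OF s] L l cd0 D'0 by (simp add: C add_pos_nonneg)
  have E0: "0 \<le> E"
    unfolding E_def using A \<omega> C0 l cd0 h tail_const_pos[OF s(1)] L \<epsilon> by (intro add_nonneg_nonneg mult_nonneg_nonneg) auto
  have T0: "0 < T" "T < r powr (2 * s)" using h r by (auto simp: T_def)
  let ?Q = "par_cyl s r :: ('a \<times> real) set"
  define S where "S = (SUP p\<in>?Q. u p)"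
  define I where "I = (INF p\<in>?Q. u p)"
  have bdd: "bdd_above (u ` ?Q)" "bdd_below (u ` ?Q)"
    using osc[OF _ big(1)] osc[OF big(1)]
    by (auto intro!: bdd_aboveI2[of _ _ "u p1 + \<omega>"] bdd_belowI2[of _ "u p1 - \<omega>"] simp: algebra_simps)
  have uS: "u p \<le> S" and uI: "I \<le> u p" if "p \<in> ?Q" for p
    unfolding S_def I_def using that bdd by (auto intro: cSUP_upper cINF_lower)
  have Sle: "S \<le> c" if "\<And>p. p \<in> ?Q \<Longrightarrow> u p \<le> c" for c
    unfolding S_def using that big(1) by (intro cSUP_least) auto
  have Ige: "c \<le> I" if "\<And>p. p \<in> ?Q \<Longrightarrow> c \<le> u p" for c
    unfolding I_def using that big(1) by (intro cINF_greatest) auto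
  have SI: "S - I \<le> \<omega>"
  proof -
    have "S \<le> u q + \<omega>" if "q \<in> ?Q" for q using osc[OF _ that] by (intro Sle) (simp add: algebra_simps)
    then have "S - \<omega> \<le> I" by (intro Ige) (simp add: algebra_simps)
    then show ?thesis by simp
  qed
  have SI2: "\<mu> * \<omega> \<le> S - I" using uS[OF big(1)] uI[OF big(2)] big(3) by linarith
  have upper_p: "u (x, t) \<le> S - deficit s l r T S u t * bump r x + E * (t + T)"
    if "norm x \<le> r / 2" "- T \<le> t" "t \<le> 0" for x t
  proof (rule one_sided_improvement[OF s l L D A sub(1) \<rho> r h \<omega> \<epsilon> _ _ _ cd T_def C E_def that])
    show "u p \<le> S" if "p \<in> ?Q" for p by (rule uS[OF that])
    show "S - \<omega> \<le> u p" if "p \<in> ?Q" for p using uI[OF that] SI by linarith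
    show "u (x, t) \<le> S + \<epsilon> * \<omega> * (norm x / r) powr s" if "t \<in> time_int s r" "r \<le> norm x" for x t
    proof -
      have "u (x, t) - (\<mu> * \<omega> + \<epsilon> * \<omega> * (norm x / r) powr s) \<le> I"
        using tail[OF that] by (intro Ige) (auto simp: abs_le_iff algebra_simps)
      then show ?thesis using SI2 by linarith
    qed
  qed
  have lower_p: "- u (x, t) \<le> - I - deficit s l r T (- I) (\<lambda>p. - u p) t * bump r x + E * (t + T)"
    if "norm x \<le> r / 2" "- T \<le> t" "t \<le> 0" for x t
  proof (rule one_sided_improvement[OF s l L D A sub(2) \<rho> r h \<omega> \<epsilon> _ _ _ cd T_def C E_def that])
    show "- u p \<le> - I" if "p \<in> ?Q" for p using uI[OF that] by simp
    show "- I - \<omega> \<le> - u p" if "p \<in> ?Q" for p using uS[OF that] SI by linarith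
    show "- u (x, t) \<le> - I + \<epsilon> * \<omega> * (norm x / r) powr s" if "t \<in> time_int s r" "r \<le> norm x" for x t
    proof -
      have "S \<le> u (x, t) + (\<mu> * \<omega> + \<epsilon> * \<omega> * (norm x / r) powr s)"
        using tail[OF that] by (intro Sle) (auto simp: abs_le_iff algebra_simps)
      then show ?thesis using SI2 by linarith
    qed
  qed
  have "r powr (2 * s) \<le> R powr (2 * s)" using r s by (intro powr_mono2) auto
  then have cont: "continuous_on ?Q u"
    using sub(1) r by (auto simp: subsolution_def par_cyl_def time_int_def intro: continuous_on_subset)
  then have cont': "continuous_on ?Q (\<lambda>p. - u p)" by (rule continuous_on_minus)
  have lowS: "S - \<omega> \<le> u p" if "p \<in> ?Q" for p using uI[OF that] SI by linarith
  have upI: "- u p \<le> - I" if "p \<in> ?Q" for p using uI[OF that] by simp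
  have lowI: "- I - \<omega> \<le> - u p" if "p \<in> ?Q" for p using uS[OF that] SI by linarith
  note c1 = r(1) l T0 cont uS lowS cd
  note c2 = r(1) l T0 cont' upI lowI cd
  define M1 where "M1 = deficit s l r T S u"
  define M2 where "M2 = deficit s l r T (- I) (\<lambda>p. - u p)"
  have sum: "M1 (- T / 2) + M2 (- T / 2) = l * cd * h * (S - I) / 2"
  proof -
    have rates: "deficit_rate s l r S u t + deficit_rate s l r (- I) (\<lambda>p. - u p) t = l * cd * \<nu> * (S - I)"
      if t: "- T \<le> t" "t \<le> 0" for t
    proof -
      have iS: "(\<lambda>x. S - u (x, t)) integrable_on avg_box r"
        using box_slice_integrable[OF c1 t] by (intro integrable_diff) (auto simp: avg_box_def)
      have iI: "(\<lambda>x. - I - - u (x, t)) integrable_on avg_box r"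
        using box_slice_integrable[OF c2 t] by (intro integrable_diff) (auto simp: avg_box_def)
      have "integral (avg_box r) (\<lambda>x. S - u (x, t)) + integral (avg_box r) (\<lambda>x. - I - - u (x, t))
          = integral (avg_box r) (\<lambda>x::'a. S - I)"
        using iS iI by (subst Henstock_Kurzweil_Integration.integral_add[symmetric]) (auto intro!: integral_cong)
      also have "\<dots> = measure lborel (avg_box r :: 'a set) * (S - I)"
        by (simp add: avg_box_def)
      finally have sum: "integral (avg_box r) (\<lambda>x. S - u (x, t)) + integral (avg_box r) (\<lambda>x. - I - - u (x, t))
          = measure lborel (avg_box r :: 'a set) * (S - I)" .
      have "deficit_rate s l r S u t + deficit_rate s l r (- I) (\<lambda>p. - u p) t
          = (l * r powr (- real DIM('a) - 2 * s) * measure lborel (avg_box r :: 'a set)) * (S - I)"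
        unfolding deficit_rate_def distrib_left[symmetric] sum by simp
      then show ?thesis unfolding box_mass[OF r(1) cd] \<nu>_def .
    qed
    have "M1 (- T / 2) + M2 (- T / 2)
        = integral {- T..- T / 2} (\<lambda>t. deficit_rate s l r S u t + deficit_rate s l r (- I) (\<lambda>p. - u p) t)"
      unfolding M1_def M2_def deficit_def using T0
      by (intro Henstock_Kurzweil_Integration.integral_add[symmetric]
          deficit_rate_integrable[OF c1] deficit_rate_integrable[OF c2]) auto
    also have "\<dots> = integral {- T..- T / 2} (\<lambda>t. l * cd * \<nu> * (S - I))"
      using rates T0 by (intro integral_cong) auto
    also have "\<dots> = l * cd * (S - I) * (\<nu> * r powr (2 * s)) * h / 2"
      using T0 by (simp add: T_def)
    finally show ?thesis unfolding \<nu>' by simp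
  qed
  have gain: "m t' / 2 \<le> m t * bump r x"
    if m: "m t' \<le> m t" "0 \<le> m t" and x: "norm x \<le> r / 4" for m :: "real \<Rightarrow> real" and t t' and x :: 'a
  proof -
    have "(norm x)\<^sup>2 \<le> (r / 4)\<^sup>2" using x by (intro power_mono) auto
    moreover have "(r / 4)\<^sup>2 = r\<^sup>2 / 16" by (simp add: power_divide)
    moreover have "0 \<le> r\<^sup>2" by simp
    ultimately have "8 * (norm x)\<^sup>2 \<le> r\<^sup>2" by linarith
    then have "1 / 2 \<le> bump r x" using r by (simp add: bump_def field_simps)
    then have "m t * (1 / 2) \<le> m t * bump r x" using m by (intro mult_left_mono)
    then show ?thesis using m by simp
  qed
  have small_cyl: "norm x \<le> r / 4 \<and> - T / 2 \<le> t \<and> t \<le> 0" if "(x, t) \<in> par_cyl s (\<eta> * r)" for x :: 'a and t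
  proof -
    have "norm x < \<eta> * r" "- ((\<eta> * r) powr (2 * s)) < t" "t \<le> 0"
      using that by (auto simp: par_cyl_def time_int_def)
    moreover have "\<eta> * r \<le> 1 / 4 * r" using \<eta> r by (intro mult_right_mono) auto
    moreover have "(\<eta> * r) powr (2 * s) \<le> h / 2 * r powr (2 * s)"
      using \<eta> r by (simp add: powr_mult mult_right_mono)
    ultimately show ?thesis by (simp add: T_def)
  qed
  obtain x t y t' where pq: "p = (x, t)" "q = (y, t')" by (cases p, cases q)
  have x: "norm x \<le> r / 4" "- T / 2 \<le> t" "t \<le> 0" and y: "norm y \<le> r / 4" "- T / 2 \<le> t'" "t' \<le> 0"
    using small_cyl p q by (auto simp: pq)
  have "M1 (- T / 2) / 2 \<le> M1 t * bump r x"
    unfolding M1_def using x T0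
    by (intro gain deficit_mono[OF c1] deficit_bounds(1)[OF c1]) auto
  moreover have "M2 (- T / 2) / 2 \<le> M2 t' * bump r y"
    unfolding M2_def using y T0
    by (intro gain deficit_mono[OF c2] deficit_bounds(1)[OF c2]) auto
  moreover have "u (x, t) \<le> S - M1 t * bump r x + E * (t + T)"
    unfolding M1_def using x T0 r by (intro upper_p) auto
  moreover have "- u (y, t') \<le> - I - M2 t' * bump r y + E * (t' + T)"
    unfolding M2_def using y T0 r by (intro lower_p) auto
  moreover have "E * (t + T) \<le> E * T" "E * (t' + T) \<le> E * T"
    using E0 x y by (auto intro!: mult_left_mono)
  ultimately have "u p - u q \<le> (S - I) - l * cd * h * (S - I) / 4 + 2 * (E * T)"
    using sum by (simp add: pq)
  moreover have "l * cd * h * (\<omega> / 2) \<le> l * cd * h * (S - I)"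
  proof -
    have "1 / 2 * \<omega> \<le> \<mu> * \<omega>" using \<mu> \<omega> by (intro mult_right_mono) auto
    then have "\<omega> / 2 \<le> S - I" using SI2 by linarith
    then show ?thesis using l cd0 h by (intro mult_left_mono) auto
  qed
  moreover have "2 * (E * T) \<le> 3 * (l * cd * h * \<omega>) / 32"
  proof -
    have "E * T = A * h * r powr (2 * s) + h * \<omega> * (2 * C * (l * cd) * h + tail_const s * L * \<epsilon>) * (\<nu> * r powr (2 * s))"
      by (simp add: E_def T_def \<nu>_def algebra_simps)
    then have "E * T = h * (A * r powr (2 * s)) + 2 * (l * cd * h * \<omega>) * (C * h) + h * \<omega> * (tail_const s * L * \<epsilon>)"
      unfolding \<nu>' by (simp add: algebra_simps)
    moreover have "h * (A * r powr (2 * s)) \<le> h * (l * cd * \<omega> / 64)"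
      using small h by (intro mult_left_mono) auto
    moreover have "2 * (l * cd * h * \<omega>) * (C * h) \<le> 2 * (l * cd * h * \<omega>) * (1 / 128)"
      using small l cd0 h \<omega> by (intro mult_left_mono) auto
    moreover have "h * \<omega> * (tail_const s * L * \<epsilon>) \<le> h * \<omega> * (l * cd / 64)"
      using small h \<omega> by (intro mult_left_mono) auto
    ultimately show ?thesis by (simp add: field_simps)
  qed
  ultimately show ?thesis using SI by (simp add: field_simps)
qed

lemma powr_le_affine:
  fixes z :: real
  assumes "0 < z" "0 \<le> \<theta>" "\<theta> \<le> 1"
  shows "z powr (\<theta> * s) \<le> \<theta> * z powr s + (1 - \<theta>)"
proof -
  have "exp ((1 - \<theta>) *\<^sub>R 0 + \<theta> *\<^sub>R (s * ln z)) \<le> (1 - \<theta>) * exp 0 + \<theta> * exp (s * ln z)"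
    using assms by (intro convex_onD[OF exp_convex]) auto
  then show ?thesis using assms by (simp add: powr_def mult_ac)
qed

text \<open>
  Here \<open>k\<close> stands for the lower bound \<open>l\<close> times the volume factor of the box, and \<open>C\<close>, \<open>B\<close> for the
  constants in the errors. The order of the choices matters: the length \<open>h\<close> of the time interval, then the ratio \<open>\<eta>\<close> of
  consecutive scales, and the exponent \<open>\<alpha>\<close> last, so small that \<open>\<eta>\<^sup>\<alpha>\<close> is close to 1. For the tail one
  uses \<open>z\<^sup>\<alpha> - 1 \<le> (\<alpha>/s) (z\<^sup>s - 1)\<close>: it trades the excess for a small multiple of \<open>z\<^sup>s\<close>, whose moment
  at infinity is finite.
\<close>

lemma uniform_constants_exist:
  assumes s: "0 < (s::real)" and k: "0 < (k::real)" and C: "0 < C" and B: "0 < B"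
  shows "\<exists>h \<eta> \<epsilon> \<alpha>. 0 < h \<and> h < 1 \<and> C * h \<le> 1 / 128 \<and> 0 < \<eta> \<and> \<eta> \<le> 1 / 4 \<and> \<eta> powr (2 * s) \<le> h / 2
     \<and> 0 < \<epsilon> \<and> 64 * B * \<epsilon> \<le> k \<and> 0 < \<alpha> \<and> \<alpha> < 2 * s \<and> 1 / 2 \<le> \<eta> powr \<alpha> \<and> 1 - k * h / 32 \<le> \<eta> powr \<alpha>
     \<and> (\<forall>z\<ge>1. z powr \<alpha> / \<eta> powr \<alpha> \<le> \<eta> powr \<alpha> + \<epsilon> * z powr s)"
proof -
  define h where "h = min (1 / 2) (1 / (128 * C))"
  define \<eta> where "\<eta> = min (1 / 4) ((h / 2) powr (1 / (2 * s)))"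
  define \<epsilon> where "\<epsilon> = k / (64 * B)"
  have h: "0 < h" "h < 1" "C * h \<le> 1 / 128" using C by (auto simp: h_def min_def field_simps)
  have \<eta>: "0 < \<eta>" "\<eta> \<le> 1 / 4" using h by (auto simp: \<eta>_def)
  have "\<eta> powr (2 * s) \<le> ((h / 2) powr (1 / (2 * s))) powr (2 * s)"
    using \<eta> s by (intro powr_mono2) (auto simp: \<eta>_def)
  also have "\<dots> = h / 2" using h s by (simp add: powr_powr)
  finally have \<eta>2: "\<eta> powr (2 * s) \<le> h / 2" .
  have \<epsilon>: "0 < \<epsilon>" "64 * B * \<epsilon> \<le> k" using k B by (auto simp: \<epsilon>_def)
  have l1: "((\<lambda>\<alpha>. \<eta> powr \<alpha>) \<longlongrightarrow> \<eta> powr 0) (at_right 0)"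
    using \<eta> by (intro tendsto_intros) auto
  then have l1: "((\<lambda>\<alpha>. \<eta> powr \<alpha>) \<longlongrightarrow> 1) (at_right 0)" using \<eta> by simp
  have l2: "((\<lambda>\<alpha>. (\<alpha> / s) / \<eta> powr \<alpha> + 1 / \<eta> powr \<alpha> - \<eta> powr \<alpha>) \<longlongrightarrow> (0 / s) / 1 + 1 / 1 - 1) (at_right 0)"
    using s by (intro tendsto_intros l1) auto
  have "\<forall>\<^sub>F \<alpha> in at_right 0. max (1 / 2) (1 - k * h / 32) < \<eta> powr \<alpha>"
    using k h by (intro order_tendstoD(1)[OF l1]) auto
  moreover have "\<forall>\<^sub>F \<alpha> in at_right 0. (\<alpha> / s) / \<eta> powr \<alpha> + 1 / \<eta> powr \<alpha> - \<eta> powr \<alpha> < \<epsilon>"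
    using \<epsilon> by (intro order_tendstoD(2)[OF l2]) auto
  moreover have "\<forall>\<^sub>F \<alpha> in at_right 0. 0 < \<alpha> \<and> \<alpha> < s"
    using eventually_at_right_less[of "0::real"] eventually_at_rightI[of 0 s "\<lambda>\<alpha>. \<alpha> < s"] s
    by (auto intro: eventually_conj)
  ultimately have "\<forall>\<^sub>F \<alpha> in at_right 0. max (1 / 2) (1 - k * h / 32) < \<eta> powr \<alpha>
      \<and> (\<alpha> / s) / \<eta> powr \<alpha> + 1 / \<eta> powr \<alpha> - \<eta> powr \<alpha> < \<epsilon> \<and> 0 < \<alpha> \<and> \<alpha> < s"
    by eventually_elim auto
  then obtain \<alpha> where \<alpha>: "max (1 / 2) (1 - k * h / 32) < \<eta> powr \<alpha>"
      "(\<alpha> / s) / \<eta> powr \<alpha> + 1 / \<eta> powr \<alpha> - \<eta> powr \<alpha> < \<epsilon>" "0 < \<alpha>" "\<alpha> < s"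
    using eventually_happens'[OF trivial_limit_at_right_real] by blast
  define \<mu> where "\<mu> = \<eta> powr \<alpha>"
  have \<mu>: "0 < \<mu>" "\<mu> \<le> 1" using \<alpha> \<eta> powr_le1[of \<alpha> \<eta>] by (auto simp: \<mu>_def)
  have "z powr \<alpha> / \<mu> \<le> \<mu> + \<epsilon> * z powr s" if z: "1 \<le> z" for z
  proof -
    have zs: "1 \<le> z powr s" using z s by (simp add: ge_one_powr_ge_zero)
    have "z powr \<alpha> \<le> (\<alpha> / s) * z powr s + (1 - \<alpha> / s)"
      using powr_le_affine[of z "\<alpha> / s" s] z \<alpha> s by simp
    also have "\<dots> \<le> (\<alpha> / s) * z powr s + 1" using \<alpha> s by simp
    finally have "z powr \<alpha> / \<mu> \<le> ((\<alpha> / s) * z powr s + 1) / \<mu>" using \<mu> by (intro divide_right_mono) auto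
    also have "\<dots> = \<mu> + (\<alpha> / s / \<mu>) * z powr s + (1 / \<mu> - \<mu>) * 1" using \<mu> by (simp add: field_simps)
    also have "\<dots> \<le> \<mu> + (\<alpha> / s / \<mu>) * z powr s + (1 / \<mu> - \<mu>) * z powr s"
    proof -
      have "\<mu> * \<mu> \<le> 1" using \<mu> by (simp add: mult_le_one)
      then have "0 \<le> 1 / \<mu> - \<mu>" using \<mu> by (simp add: field_simps)
      then show ?thesis using mult_left_mono[OF zs, of "1 / \<mu> - \<mu>"] by simp
    qed
    also have "\<dots> = \<mu> + (\<alpha> / s / \<mu> + 1 / \<mu> - \<mu>) * z powr s" by (simp add: algebra_simps)
    also have "\<dots> \<le> \<mu> + \<epsilon> * z powr s"
      using \<alpha>(2) zs by (intro add_mono mult_right_mono) (auto simp: \<mu>_def)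
    finally show ?thesis .
  qed
  then show ?thesis
    using h \<eta> \<eta>2 \<epsilon> \<alpha> s unfolding \<mu>_def
    by (intro exI[of _ h] exI[of _ \<eta>] exI[of _ \<epsilon>] exI[of _ \<alpha>]) auto
qed

lemma scale_between:
  fixes \<eta> R z :: real
  assumes "0 < \<eta>" "\<eta> < 1" "0 < z" "z < R"
  shows "\<exists>j. \<eta> ^ Suc j * R \<le> z \<and> z < \<eta> ^ j * R"
proof -
  define i where "i = (LEAST i. \<eta> ^ i * R \<le> z)"
  have "0 < z / R" using assms by simp
  then obtain n where "\<eta> ^ n < z / R" using real_arch_pow_inv[of "z / R" \<eta>] assms by auto
  then have "\<eta> ^ n * R \<le> z" using assms by (simp add: field_simps)
  then have i: "\<eta> ^ i * R \<le> z" unfolding i_def by (rule LeastI)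
  then obtain j where j: "i = Suc j" using assms by (cases i) auto
  then have "\<not> \<eta> ^ j * R \<le> z" unfolding i_def using not_less_Least[of j "\<lambda>i. \<eta> ^ i * R \<le> z"] by simp
  then show ?thesis using i j by auto
qed

lemma par_cyl_mono: "0 < s \<Longrightarrow> 0 \<le> r \<Longrightarrow> r \<le> r' \<Longrightarrow> par_cyl s r \<subseteq> par_cyl s r'"
  using powr_mono2[of "2 * s" r r'] by (auto simp: par_cyl_def time_int_def)

lemma powr_nat_scale:
  assumes "0 < (\<eta>::real)" shows "(\<eta> powr \<alpha>) ^ k = (\<eta> ^ k) powr \<alpha>"
  using assms by (simp add: powr_realpow[symmetric] powr_powr mult.commute)

text \<open>
  At scale \<open>r = \<eta>\<^sup>k R\<close> either the oscillation is already below \<open>\<mu>\<close> times the current bound, and there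
  is nothing to do, or \<open>oscillation_step\<close> applies: the values of \<open>u\<close> at distance about \<open>\<eta>\<^sup>i R\<close> from the origin
  differ from those in the cylinder by at most \<open>\<omega> \<mu>\<^sup>i\<close>, the current bound times a power of \<open>|x|/r\<close>. The condition \<open>\<alpha> < 2 s\<close>
  makes \<open>A r\<^sup>2\<^sup>s\<close> decay faster than the oscillation.
\<close>

lemma oscillation_decay:
  fixes u :: "'a::euclidean_space \<times> real \<Rightarrow> real"
  assumes s: "0 < s" "s < 1" and l: "0 < l" and L: "0 < L"
    and D: "0 \<le> D" "\<And>r. 0 < r \<Longrightarrow> r \<le> R \<Longrightarrow> D * r powr (2 * s - 1) \<le> D'"
    and A: "0 \<le> A" and sub: "subsolution s l L \<rho> D A R u" "subsolution s l L \<rho> D A R (\<lambda>p. - u p)"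
    and \<rho>: "0 \<le> \<rho>" and R: "0 < R"
    and h: "0 < h" "h < 1" and \<epsilon>: "0 \<le> \<epsilon>"
    and cd: "cd = (1 / (2 * real DIM('a))) ^ DIM('a)"
    and C: "C = diffusion_const s * L + l * cd + 4 * D'"
    and small: "C * h \<le> 1 / 128" "64 * tail_const s * L * \<epsilon> \<le> l * cd"
    and \<eta>: "0 < \<eta>" "\<eta> \<le> 1 / 4" "\<eta> powr (2 * s) \<le> h / 2"
    and \<alpha>: "0 < \<alpha>" "\<alpha> < 2 * s"
    and \<mu>: "\<mu> = \<eta> powr \<alpha>" "1 / 2 \<le> \<mu>" "1 - l * cd * h / 32 \<le> \<mu>"
    and tail: "\<And>z. 1 \<le> z \<Longrightarrow> z powr \<alpha> / \<mu> \<le> \<mu> + \<epsilon> * z powr s"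
    and N: "\<And>x t. t \<in> time_int s R \<Longrightarrow> \<bar>u (x, t)\<bar> \<le> N"
    and \<omega>: "0 < \<omega>" "2 * N \<le> \<omega>" "64 * A * R powr (2 * s) \<le> l * cd * \<omega>"
    and scales: "\<And>j. j < k \<Longrightarrow> \<rho> \<le> \<eta> ^ j * R"
  shows "j \<le> k \<Longrightarrow> p \<in> par_cyl s (\<eta> ^ j * R) \<Longrightarrow> q \<in> par_cyl s (\<eta> ^ j * R) \<Longrightarrow> u p - u q \<le> \<omega> * \<mu> ^ j"
  using scales
proof (induction k arbitrary: j p q)
  case 0
  then have "p \<in> UNIV \<times> time_int s R" "q \<in> UNIV \<times> time_int s R" by (auto simp: par_cyl_def)
  then have "\<bar>u p\<bar> \<le> N" "\<bar>u q\<bar> \<le> N" using N by (cases p, cases q, auto)+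
  then show ?case using 0 \<omega> by simp
next
  case (Suc k)
  have IH: "u p - u q \<le> \<omega> * \<mu> ^ j" if "j \<le> k" "p \<in> par_cyl s (\<eta> ^ j * R)" "q \<in> par_cyl s (\<eta> ^ j * R)" for j p q
    using Suc.IH[OF that] Suc.prems(4) by simp
  show ?case
  proof (cases "j \<le> k")
    case True
    then show ?thesis using IH Suc.prems by blast
  next
    case False
    then have j: "j = Suc k" using Suc.prems by simp
    define r where "r = \<eta> ^ k * R"
    define w where "w = \<omega> * \<mu> ^ k"
    have \<eta>k: "0 < \<eta> ^ k" "\<eta> ^ k \<le> 1" using \<eta> by (auto simp: power_le_one)
    have r: "0 < r" "r \<le> R" using \<eta>k R mult_right_mono[of "\<eta> ^ k" 1 R] by (auto simp: r_def)
    have \<mu>0: "0 < \<mu>" using \<mu>(2) by linarith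
    have w: "0 < w" using \<omega> \<mu>0 by (simp add: w_def)
    have \<rho>r: "\<rho> \<le> r" using Suc.prems(4)[of k] by (simp add: r_def)
    have sub_r: "par_cyl s (\<eta> * r) \<subseteq> (par_cyl s r :: ('a \<times> real) set)"
      using s \<eta> r mult_right_mono[of \<eta> 1 r] by (intro par_cyl_mono) auto
    have pq: "p \<in> par_cyl s (\<eta> * r)" "q \<in> par_cyl s (\<eta> * r)"
      using Suc.prems by (auto simp: j r_def mult.assoc)
    have cd0: "0 < cd" by (simp add: cd)
    have "u p - u q \<le> \<mu> * w"
    proof (cases "\<exists>p1\<in>par_cyl s r. \<exists>q1\<in>par_cyl s r. \<mu> * w \<le> u p1 - u q1")
      case False
      then show ?thesis using pq sub_r by (meson less_imp_le not_le subsetD)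
    next
      case True
      then obtain p1 q1 where big: "p1 \<in> par_cyl s r" "q1 \<in> par_cyl s r" "\<mu> * w \<le> u p1 - u q1" by blast
      have osc_r: "u p - u q \<le> w" if "p \<in> par_cyl s r" "q \<in> par_cyl s r" for p q
        using IH[of k p q] that by (simp add: r_def w_def)
      have tail_r: "\<bar>u (x, t) - u q\<bar> \<le> \<mu> * w + \<epsilon> * w * (norm x / r) powr s"
        if t: "t \<in> time_int s r" and x: "r \<le> norm x" and q: "q \<in> par_cyl s r" for x t q
      proof -
        define z where "z = norm x / r"
        have z: "1 \<le> z" using x r by (simp add: z_def)
        have tR: "t \<in> time_int s R"
          using t powr_mono2[of "2 * s" r R] s r by (auto simp: time_int_def)
        have "\<bar>u (x, t) - u q\<bar> \<le> w * (z powr \<alpha> / \<mu>)"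
        proof (cases "norm x < R")
          case False
          have "q \<in> UNIV \<times> time_int s R"
            using q par_cyl_mono[of s r R] s r by (auto simp: par_cyl_def)
          then have "\<bar>u q\<bar> \<le> N" using N by (cases q) auto
          then have "\<bar>u (x, t) - u q\<bar> \<le> \<omega>" using N[OF tR, of x] \<omega> by linarith
          also have "\<omega> = w * (1 / \<eta> ^ k) powr \<alpha>"
            using \<eta>k \<mu>0 \<eta> by (simp add: w_def \<mu>(1) powr_nat_scale powr_divide)
          also have "\<dots> \<le> w * z powr \<alpha>"
          proof -
            have "1 / \<eta> ^ k \<le> z" using False \<eta>k R by (simp add: z_def r_def field_simps)
            then show ?thesis using w \<alpha> \<eta>k by (intro mult_left_mono powr_mono2) auto
          qed
          also have "\<dots> \<le> w * (z powr \<alpha> / \<mu>)"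
          proof -
            have "\<mu> \<le> 1" using \<mu>(1) \<eta> \<alpha> powr_le1[of \<alpha> \<eta>] by auto
            then have "\<mu> * z powr \<alpha> \<le> 1 * z powr \<alpha>" by (intro mult_right_mono) auto
            then show ?thesis using w \<mu>0 by (intro mult_left_mono) (auto simp: field_simps)
          qed
          finally show ?thesis .
        next
          case True
          have "0 < norm x" using x r by linarith
          then obtain i where i: "\<eta> ^ Suc i * R \<le> norm x" "norm x < \<eta> ^ i * R"
            using scale_between[of \<eta> "norm x" R] True \<eta> by auto
          have ik: "i < k"
          proof (rule ccontr)
            assume "\<not> i < k"
            then have "\<eta> ^ i * R \<le> \<eta> ^ k * R" using \<eta> R by (intro mult_right_mono power_decreasing) auto
            then show False using i x by (simp add: r_def)
          qed
          have ri: "r \<le> \<eta> ^ i * R" unfolding r_def using \<eta> R ik by (intro mult_right_mono power_decreasing) auto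
          have ti: "t \<in> time_int s (\<eta> ^ i * R)"
            using t powr_mono2[of "2 * s" r "\<eta> ^ i * R"] s r ri by (auto simp: time_int_def)
          then have xi: "(x, t) \<in> par_cyl s (\<eta> ^ i * R)" using i by (simp add: par_cyl_def)
          have qi: "q \<in> par_cyl s (\<eta> ^ i * R)" using q par_cyl_mono[OF s(1) _ ri] r by auto
          have "\<bar>u (x, t) - u q\<bar> \<le> \<omega> * \<mu> ^ i"
            using IH[OF _ xi qi] IH[OF _ qi xi] ik by (simp add: abs_le_iff)
          also have "\<dots> = w * ((\<eta> ^ Suc i / \<eta> ^ k) powr \<alpha> / \<mu>)"
          proof -
            have "(\<eta> ^ Suc i / \<eta> ^ k) powr \<alpha> = \<mu> ^ Suc i / \<mu> ^ k"
              using \<eta> by (simp only: \<mu>(1) powr_nat_scale powr_divide)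
            then show ?thesis using \<mu>0 by (simp add: w_def)
          qed
          also have "\<dots> \<le> w * (z powr \<alpha> / \<mu>)"
          proof -
            have "\<eta> ^ Suc i / \<eta> ^ k \<le> z" using i \<eta>k R by (simp add: z_def r_def field_simps)
            then show ?thesis using w \<mu>0 \<alpha> \<eta> by (intro mult_left_mono divide_right_mono powr_mono2) auto
          qed
          finally show ?thesis .
        qed
        also have "\<dots> \<le> w * (\<mu> + \<epsilon> * z powr s)" using tail[OF z] w by (intro mult_left_mono) auto
        finally show ?thesis by (simp add: z_def algebra_simps)
      qed
      have "64 * A * r powr (2 * s) \<le> l * cd * w"
      proof -
        have "64 * A * r powr (2 * s) = (64 * A * R powr (2 * s)) * (\<eta> ^ k) powr (2 * s)"
          using \<eta>k R by (simp add: r_def powr_mult)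
        also have "\<dots> \<le> (l * cd * \<omega>) * (\<eta> ^ k) powr \<alpha>"
          using \<omega>(1) \<eta>k \<alpha> l cd0 by (intro mult_mono[OF \<omega>(3)] powr_mono') auto
        also have "\<dots> = l * cd * w" using \<eta> by (simp add: w_def \<mu>(1) powr_nat_scale)
        finally show ?thesis .
      qed
      then have "u p - u q \<le> (1 - l * cd * h / 32) * w"
        using oscillation_step[OF s l L D(1) D(2)[OF r] A sub \<rho> \<rho>r r h w \<epsilon> \<mu>(2) osc_r big tail_r cd C small _ \<eta> pq] by blast
      also have "\<dots> \<le> \<mu> * w" using \<mu> w by (intro mult_right_mono) auto
      finally show ?thesis .
    qed
    then show ?thesis by (simp add: j w_def mult_ac)
  qed
qed

section \<open>Hoelder estimate at the origin\<close>

lemma mem_par_cyl_iff: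
  assumes "0 < s" "0 < r" "t \<le> 0"
  shows "(x, t) \<in> par_cyl s r \<longleftrightarrow> par_dist s (x, t) (0, 0) < r"
proof -
  have "\<bar>t\<bar> powr (1 / (2 * s)) < r \<longleftrightarrow> - (r powr (2 * s)) < t"
  proof -
    have "\<bar>t\<bar> powr (1 / (2 * s)) < r \<longleftrightarrow> (\<bar>t\<bar> powr (1 / (2 * s))) powr (2 * s) < r powr (2 * s)"
      using assms powr_less_mono2[of "2 * s" "\<bar>t\<bar> powr (1 / (2 * s))" r]
        powr_mono2[of "2 * s" r "\<bar>t\<bar> powr (1 / (2 * s))"]
      by (smt (verit) powr_ge_zero)
    also have "(\<bar>t\<bar> powr (1 / (2 * s))) powr (2 * s) = \<bar>t\<bar>" using assms by (simp add: powr_powr)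
    finally show ?thesis using assms by auto
  qed
  then show ?thesis using assms by (auto simp: par_cyl_def time_int_def par_dist_def)
qed

text \<open>
  A point of \<open>Q\<^sub>R\<close> outside \<open>Q\<^sub>\<rho>\<close> has distance between \<open>\<eta>\<^sup>k\<^sup>+\<^sup>1 R\<close> and \<open>\<eta>\<^sup>k R\<close> from the origin for some \<open>k\<close>.
  All scales up to the \<open>k\<close>-th are above \<open>\<rho>\<close>, so that the decay is available there.
\<close>

lemma holder_estimate:
  fixes s l L D' :: real
  assumes s: "0 < s" "s < 1" and l: "0 < l" and L: "0 < L" and D': "0 \<le> D'"
  shows "\<exists>\<alpha> C. 0 < \<alpha> \<and> \<alpha> < 2 * s \<and> 0 < C \<and>
    (\<forall>\<rho> A R D. \<forall>u :: 'a::euclidean_space \<times> real \<Rightarrow> real.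
       0 \<le> \<rho> \<and> 0 \<le> A \<and> \<rho> < R \<and> 0 \<le> D \<and> (\<forall>r. 0 < r \<longrightarrow> r \<le> R \<longrightarrow> D * r powr (2 * s - 1) \<le> D') \<and>
       subsolution s l L \<rho> D A R u \<and> subsolution s l L \<rho> D A R (\<lambda>p. - u p)
       \<longrightarrow> holder_at_origin s \<rho> A R \<alpha> C u)"
proof -
  define cd where "cd = (1 / (2 * real DIM('a))) ^ DIM('a)"
  define C where "C = diffusion_const s * L + l * cd + 4 * D'"
  have cd0: "0 < cd" by (simp add: cd_def)
  have C0: "0 < C" using diffusion_const_pos[OF s] L l cd0 D' by (simp add: C_def add_pos_nonneg)
  obtain h \<eta> \<epsilon> \<alpha> where const: "0 < h" "h < 1" "C * h \<le> 1 / 128" "0 < \<eta>" "\<eta> \<le> 1 / 4" "\<eta> powr (2 * s) \<le> h / 2"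
      "0 < \<epsilon>" "64 * (tail_const s * L) * \<epsilon> \<le> l * cd" "0 < \<alpha>" "\<alpha> < 2 * s" "1 / 2 \<le> \<eta> powr \<alpha>"
      "1 - l * cd * h / 32 \<le> \<eta> powr \<alpha>" "\<And>z. 1 \<le> z \<Longrightarrow> z powr \<alpha> / \<eta> powr \<alpha> \<le> \<eta> powr \<alpha> + \<epsilon> * z powr s"
    using uniform_constants_exist[of s "l * cd" C "tail_const s * L"] s l cd0 C0 L tail_const_pos[OF s(1)] by auto
  define \<mu> where "\<mu> = \<eta> powr \<alpha>"
  define c where "c = 2 + 64 / (l * cd)"
  have c: "0 < c" "2 \<le> c" "64 \<le> l * cd * c" using l cd0 by (auto simp: c_def field_simps add_pos_pos)
  have \<mu>: "0 < \<mu>" using const by (simp add: \<mu>_def)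
  have "holder_at_origin s \<rho> A R \<alpha> (c / \<mu>) u"
    if \<rho>: "0 \<le> \<rho>" "\<rho> < R" and A: "0 \<le> A" and D: "0 \<le> D" "\<And>r. 0 < r \<Longrightarrow> r \<le> R \<Longrightarrow> D * r powr (2 * s - 1) \<le> D'"
      and sub: "subsolution s l L \<rho> D A R u" "subsolution s l L \<rho> D A R (\<lambda>p. - u p)"
    for \<rho> A R D and u :: "'a \<times> real \<Rightarrow> real"
    unfolding holder_at_origin_def
  proof (intro allI impI)
    fix x :: 'a and t
    assume xt: "(x, t) \<in> par_cyl s R - par_cyl s \<rho> \<and> (\<rho> = 0 \<longrightarrow> (x, t) \<noteq> (0, 0))"
    have R: "0 < R" using \<rho> by simp
    define N where "N = sup_norm (time_int s R) u"
    have "bounded (u ` (UNIV \<times> time_int s R))" using sub by (simp add: subsolution_def bdd_borel_def)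
    then obtain b where "\<And>y. y \<in> u ` (UNIV \<times> time_int s R) \<Longrightarrow> norm y \<le> b"
      unfolding bounded_iff by blast
    then have bd: "bdd_above ((\<lambda>p. \<bar>u p\<bar>) ` (UNIV \<times> time_int s R))"
      by (intro bdd_aboveI2[of _ _ b]) auto
    have N: "\<bar>u (x, t)\<bar> \<le> N" if "t \<in> time_int s R" for x t
      unfolding N_def sup_norm_def using that by (intro cSUP_upper2[OF bd, of "(x, t)"]) auto
    have t0: "t \<le> 0" using xt by (auto simp: par_cyl_def time_int_def)
    have N0: "0 \<le> N" using N[of 0 0] R by (auto simp: time_int_def)
    define F where "F = N + R powr (2 * s) * A"
    have F0: "0 \<le> F" using N0 A by (simp add: F_def)
    define d where "d = par_dist s (x, t) (0, 0)"
    have dR: "d < R" using xt mem_par_cyl_iff[OF s(1) R t0, of x] by (simp add: d_def)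
    have d0: "0 < d"
    proof (cases "\<rho> = 0")
      case True
      then have "x \<noteq> 0 \<or> t \<noteq> 0" using xt by auto
      then show ?thesis using s by (auto simp: d_def par_dist_def less_max_iff_disj)
    next
      case False
      then have "\<rho> \<le> d" using xt \<rho> mem_par_cyl_iff[OF s(1) _ t0, of \<rho> x] by (auto simp: d_def)
      then show ?thesis using False \<rho> by simp
    qed
    have \<rho>d: "\<rho> \<le> d"
      using xt \<rho> d0 mem_par_cyl_iff[OF s(1) _ t0, of \<rho> x] by (cases "\<rho> = 0") (auto simp: d_def)
    obtain k where k: "\<eta> ^ Suc k * R \<le> d" "d < \<eta> ^ k * R"
      using scale_between[of \<eta> d R] const d0 dR by auto
    have rk: "0 < \<eta> ^ k * R" using const R by simp
    have scales: "\<rho> \<le> \<eta> ^ j * R" if "j < k" for j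
    proof -
      have "\<eta> ^ k * R \<le> \<eta> ^ j * R" using that const R by (intro mult_right_mono power_decreasing) auto
      then show ?thesis using \<rho>d k by linarith
    qed
    have in_k: "(x, t) \<in> par_cyl s (\<eta> ^ k * R)" using mem_par_cyl_iff[OF s(1) rk t0, of x] k by (simp add: d_def)
    have o_k: "(0, 0) \<in> par_cyl s (\<eta> ^ k * R)" using mem_par_cyl_iff[OF s(1) rk, of 0 0] rk by (simp add: par_dist_def)
    \<comment> \<open>the decay needs a positive initial bound; \<open>F = 0\<close> forces \<open>u = 0\<close>\<close>
    have diff: "\<bar>u (x, t) - u (0, 0)\<bar> \<le> c * F * \<mu> ^ k"
    proof (cases "F = 0")
      case True
      then have "N = 0" using N0 A by (simp add: F_def add_nonneg_eq_0_iff)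
      moreover have "t \<in> time_int s R" "0 \<in> time_int s R" using xt R by (auto simp: par_cyl_def time_int_def)
      ultimately show ?thesis using N[of t x] N[of 0 0] True by simp
    next
      case False
      then have w0: "0 < c * F" using F0 c by simp
      have w1: "2 * N \<le> c * F"
        using c N0 A mult_mono[of 2 c N F] by (simp add: F_def)
      have w2: "64 * A * R powr (2 * s) \<le> l * cd * (c * F)"
      proof -
        have "64 * (R powr (2 * s) * A) \<le> (l * cd * c) * F"
          using c A N0 l cd0 by (intro mult_mono) (auto simp: F_def)
        then show ?thesis by (simp add: mult_ac)
      qed
      have sm: "64 * tail_const s * L * \<epsilon> \<le> l * cd" using const(8) by (simp add: mult_ac)
      have decay: "u p - u q \<le> c * F * \<mu> ^ k"
        if "p \<in> par_cyl s (\<eta> ^ k * R)" "q \<in> par_cyl s (\<eta> ^ k * R)" for p q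
        by (rule oscillation_decay[OF s l L D A sub \<rho>(1) R const(1,2) less_imp_le[OF const(7)] cd_def C_def const(3) sm
          const(4-6) const(9,10) \<mu>_def const(11,12)[folded \<mu>_def] const(13)[folded \<mu>_def] N w0 w1 w2 scales order_refl that])
      show ?thesis
        using decay[OF in_k o_k] decay[OF o_k in_k] by (simp add: abs_le_iff)
    qed
    have "R powr \<alpha> * \<mu> ^ Suc k = (\<eta> ^ Suc k * R) powr \<alpha>"
      using const R by (simp add: powr_mult \<mu>_def powr_nat_scale[symmetric])
    also have "\<dots> \<le> d powr \<alpha>" using k const R by (intro powr_mono2) auto
    finally have "R powr \<alpha> * \<mu> ^ Suc k \<le> d powr \<alpha>" .
    then have "c * F / \<mu> * (R powr \<alpha> * \<mu> ^ Suc k) \<le> c * F / \<mu> * d powr \<alpha>"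
      using c F0 \<mu> by (intro mult_left_mono) auto
    then have "R powr \<alpha> * (c * F * \<mu> ^ k) \<le> c * F / \<mu> * d powr \<alpha>" using \<mu> by (simp add: mult_ac)
    moreover have "R powr \<alpha> * \<bar>u (x, t) - u (0, 0)\<bar> \<le> R powr \<alpha> * (c * F * \<mu> ^ k)"
      using diff by (intro mult_left_mono) auto
    ultimately have "R powr \<alpha> * \<bar>u (x, t) - u (0, 0)\<bar> \<le> c * F / \<mu> * d powr \<alpha>" by linarith
    then show "R powr \<alpha> * (\<bar>u (x, t) - u (0, 0)\<bar> / par_dist s (x, t) (0, 0) powr \<alpha>)
        \<le> c / \<mu> * (sup_norm (time_int s R) u + R powr (2 * s) * A)"
      using d0 unfolding d_def[symmetric] N_def[symmetric] F_def[symmetric] by (simp add: field_simps)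
  qed
  then show ?thesis
    using const(9,10) c \<mu> by (intro exI[of _ \<alpha>] exI[of _ "c / \<mu>"]) auto
qed

theorem theorem3p1:
  fixes s lam Lam :: real
  assumes "0 < s" "s < 1" "0 < lam" "0 < Lam"
  shows
    "(\<forall>R0>0. \<exists>\<alpha> C. 0 < \<alpha> \<and> \<alpha> < 2 * s \<and> 0 < C \<and>
        (\<forall>\<rho> A R. \<forall>u :: (real ^ 'd) \<times> real \<Rightarrow> real.
           0 \<le> \<rho> \<and> 0 \<le> A \<and> \<rho> < R \<and> R \<le> R0 \<and>
           (kernels s lam Lam \<rho> :: (real ^ 'd \<Rightarrow> real) set) \<noteq> {} \<and>
           u \<in> bdd_borel (time_int s R) \<and> case_a s lam Lam \<rho> A R u
           \<longrightarrow> holder_at_origin s \<rho> A R \<alpha> C u))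
     \<and>
     (\<exists>\<alpha> C. 0 < \<alpha> \<and> \<alpha> < 2 * s \<and> 0 < C \<and>
        (\<forall>\<rho> A R0 R. \<forall>u :: (real ^ 'd) \<times> real \<Rightarrow> real.
           0 \<le> \<rho> \<and> 0 \<le> A \<and> 0 < R0 \<and> \<rho> < R \<and> R \<le> R0 \<and>
           (kernels s lam Lam \<rho> :: (real ^ 'd \<Rightarrow> real) set) \<noteq> {} \<and>
           u \<in> bdd_borel (time_int s R) \<and> case_b s lam Lam \<rho> A R u
           \<longrightarrow> holder_at_origin s \<rho> A R \<alpha> C u))"
proof (intro conjI allI impI)
  fix R0 :: real assume R0: "0 < R0"
  have "0 \<le> Lam * R0 powr (2 * s - 1)" using assms by simp
  from holder_estimate[OF assms this, where 'a = "real ^ 'd"]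
  obtain \<alpha> C where *: "0 < \<alpha>" "\<alpha> < 2 * s" "0 < C"
    "\<And>\<rho> A R D (u :: (real ^ 'd) \<times> real \<Rightarrow> real).
       0 \<le> \<rho> \<and> 0 \<le> A \<and> \<rho> < R \<and> 0 \<le> D \<and> (\<forall>r. 0 < r \<longrightarrow> r \<le> R \<longrightarrow> D * r powr (2 * s - 1) \<le> Lam * R0 powr (2 * s - 1)) \<and>
       subsolution s lam Lam \<rho> D A R u \<and> subsolution s lam Lam \<rho> D A R (\<lambda>p. - u p)
       \<Longrightarrow> holder_at_origin s \<rho> A R \<alpha> C u"
    by blast
  show "\<exists>\<alpha> C. 0 < \<alpha> \<and> \<alpha> < 2 * s \<and> 0 < C \<and>
        (\<forall>\<rho> A R. \<forall>u :: (real ^ 'd) \<times> real \<Rightarrow> real.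
           0 \<le> \<rho> \<and> 0 \<le> A \<and> \<rho> < R \<and> R \<le> R0 \<and>
           (kernels s lam Lam \<rho> :: (real ^ 'd \<Rightarrow> real) set) \<noteq> {} \<and>
           u \<in> bdd_borel (time_int s R) \<and> case_a s lam Lam \<rho> A R u
           \<longrightarrow> holder_at_origin s \<rho> A R \<alpha> C u)"
  proof (intro exI conjI allI impI)
    show "0 < \<alpha>" "\<alpha> < 2 * s" "0 < C" by fact+
    fix \<rho> A R and u :: "(real ^ 'd) \<times> real \<Rightarrow> real"
    assume a: "0 \<le> \<rho> \<and> 0 \<le> A \<and> \<rho> < R \<and> R \<le> R0 \<and>
           (kernels s lam Lam \<rho> :: (real ^ 'd \<Rightarrow> real) set) \<noteq> {} \<and>
           u \<in> bdd_borel (time_int s R) \<and> case_a s lam Lam \<rho> A R u"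
    then have s12: "1 / 2 \<le> s"
      and le: "visc_le (\<lambda>f x. M_plus s lam Lam \<rho> f x + Lam * norm (grad f x)) (\<lambda>_. A) (ball 0 R) (time_int s R) u"
      and ge: "visc_ge (\<lambda>f x. M_minus s lam Lam \<rho> f x - Lam * norm (grad f x)) (\<lambda>_. - A) (ball 0 R) (time_int s R) u"
      by (auto simp: case_a_def)
    have ne: "(kernels s lam Lam \<rho> :: (real ^ 'd \<Rightarrow> real) set) \<noteq> {}" using a by blast
    have "subsolution s lam Lam \<rho> Lam A R u"
      using ge ne by (intro subsolution_of_visc_le[OF le]) (auto simp: visc_ge_def)
    moreover have "subsolution s lam Lam \<rho> Lam A R (\<lambda>p. - u p)"
      using le ne by (intro subsolution_of_visc_ge[OF ge]) (auto simp: visc_le_def)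
    moreover have "Lam * r powr (2 * s - 1) \<le> Lam * R0 powr (2 * s - 1)" if "0 < r" "r \<le> R" for r
      using that a s12 assms by (intro mult_left_mono powr_mono2) auto
    ultimately show "holder_at_origin s \<rho> A R \<alpha> C u"
      using a assms by (intro *(4)[of \<rho> A R Lam u]) auto
  qed
next
  from holder_estimate[OF assms order_refl, where 'a = "real ^ 'd"]
  obtain \<alpha> C where *: "0 < \<alpha>" "\<alpha> < 2 * s" "0 < C"
    "\<And>\<rho> A R D (u :: (real ^ 'd) \<times> real \<Rightarrow> real).
       0 \<le> \<rho> \<and> 0 \<le> A \<and> \<rho> < R \<and> 0 \<le> D \<and> (\<forall>r. 0 < r \<longrightarrow> r \<le> R \<longrightarrow> D * r powr (2 * s - 1) \<le> 0) \<and>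
       subsolution s lam Lam \<rho> D A R u \<and> subsolution s lam Lam \<rho> D A R (\<lambda>p. - u p)
       \<Longrightarrow> holder_at_origin s \<rho> A R \<alpha> C u"
    by blast
  show "\<exists>\<alpha> C. 0 < \<alpha> \<and> \<alpha> < 2 * s \<and> 0 < C \<and>
        (\<forall>\<rho> A R0 R. \<forall>u :: (real ^ 'd) \<times> real \<Rightarrow> real.
           0 \<le> \<rho> \<and> 0 \<le> A \<and> 0 < R0 \<and> \<rho> < R \<and> R \<le> R0 \<and>
           (kernels s lam Lam \<rho> :: (real ^ 'd \<Rightarrow> real) set) \<noteq> {} \<and>
           u \<in> bdd_borel (time_int s R) \<and> case_b s lam Lam \<rho> A R u
           \<longrightarrow> holder_at_origin s \<rho> A R \<alpha> C u)"
  proof (intro exI conjI allI impI)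
    show "0 < \<alpha>" "\<alpha> < 2 * s" "0 < C" by fact+
    fix \<rho> A R0 R and u :: "(real ^ 'd) \<times> real \<Rightarrow> real"
    assume a: "0 \<le> \<rho> \<and> 0 \<le> A \<and> 0 < R0 \<and> \<rho> < R \<and> R \<le> R0 \<and>
           (kernels s lam Lam \<rho> :: (real ^ 'd \<Rightarrow> real) set) \<noteq> {} \<and>
           u \<in> bdd_borel (time_int s R) \<and> case_b s lam Lam \<rho> A R u"
    have le: "visc_le (\<lambda>f x. M_plus s lam Lam \<rho> f x + 0 * norm (grad f x)) (\<lambda>_. A) (ball 0 R) (time_int s R) u"
      and ge: "visc_ge (\<lambda>f x. M_minus s lam Lam \<rho> f x - 0 * norm (grad f x)) (\<lambda>_. - A) (ball 0 R) (time_int s R) u"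
      using a by (auto simp: case_b_def)
    have ne: "(kernels s lam Lam \<rho> :: (real ^ 'd \<Rightarrow> real) set) \<noteq> {}" using a by blast
    have "subsolution s lam Lam \<rho> 0 A R u"
      using ge ne by (intro subsolution_of_visc_le[OF le]) (auto simp: visc_ge_def)
    moreover have "subsolution s lam Lam \<rho> 0 A R (\<lambda>p. - u p)"
      using le ne by (intro subsolution_of_visc_ge[OF ge]) (auto simp: visc_le_def)
    ultimately show "holder_at_origin s \<rho> A R \<alpha> C u"
      using a by (intro *(4)[of \<rho> A R 0 u]) auto
  qed
qed


end
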